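(* Let $N,d\geq1$ and $m=\lceil N/2\rceil$. Let $\{\mathcal{X}_k\}$ be a finite sequence of independent random tensors in $\mathbb{T}_{N,d}$ such that, for some constant $L\geq0$, $\mathbb{E}(\mathcal{X}_k)=\mathcal{O}$ and $\|\mathcal{X}_k\|^{\bar E}\leq L$ for all $k$. Let $\mathcal{Y}=\sum_k\mathcal{X}_k$ and $\nu(\mathcal{Y})=\max\left\{\|\mathbb{E}(\mathcal{Y}\,\bar{*}\,\mathcal{Y})\|^E,\ \|\mathbb{E}(\mathcal{Y}\,\underline{*}\,\mathcal{Y})\|^E\right\}=\max\left\{\Big\|\sum_k\mathbb{E}(\mathcal{X}_k\,\bar{*}\,\mathcal{X}_k)\Big\|^E,\ \Big\|\sum_k\mathbb{E}(\mathcal{X}_k\,\underline{*}\,\mathcal{X}_k)\Big\|^E\right\}.$ Then $\mathbb{E}\big(\|\mathcal{Y}\|^{\bar E}\big)\leq\sqrt{2\nu(\mathcal{Y})\log(d^m+d^{N-m})}+\tfrac13L\log(d^m+d^{N-m}),$ and for all $t\geq0$, $\mathbb{P}\big(\|\mathcal{Y}\|^{\bar E}\geq t\big)\leq(d^m+d^{N-m})\exp\!\left(\frac{-t^2/2}{\nu(\mathcal{Y})+Lt/3}\right).$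
   Context: $\mathbb{T}_{N,d}$ is the set of real tensors of order $N$ with indices in $\{1,\ldots,d\}$. With $m=\lceil N/2\rceil$: $(\mathcal{A}\,\bar{*}\,\mathcal{B})_{i_1\ldots i_mj_1\ldots j_m}=\sum_{k_1,\ldots,k_{N-m}}a_{i_1\ldots i_mk_1\ldots k_{N-m}}b_{j_1\ldots j_mk_1\ldots k_{N-m}}\in\mathbb{T}_{2m,d}$ and $(\mathcal{A}\,\underline{*}\,\mathcal{B})_{k_1\ldots k_{N-m}k'_1\ldots k'_{N-m}}=\sum_{i_1,\ldots,i_m}a_{i_1\ldots i_mk_1\ldots k_{N-m}}b_{i_1\ldots i_mk'_1\ldots k'_{N-m}}\in\mathbb{T}_{2(N-m),d}$ (empty index ranges when $N-m=0$). For $\mathcal{C}\in\mathbb{T}_{2p,d}$ that is Einstein-symmetric ($c_{i_1\ldots i_pj_1\ldots j_p}=c_{j_1\ldots j_pi_1\ldots i_p}$), the Einstein-eigenvalues are the eigenvalues of the symmetric matrix $f(\mathcal{C})\in\mathbb{R}^{d^p\times d^p}$, $f(\mathcal{C})_{ij}=c_{i_1\ldots i_pj_1\ldots j_p}$, $i=i_1+\sum_{l=2}^p(i_l-1)d^{l-1}$, $j$ likewise (equivalently the diagonal entries of $\mathcal{D}$ in an Einstein eigenvalue decomposition), and $\|\mathcal{C}\|^E$ is their maximum absolute value. The generalized spectral norm is $\|\mathcal{A}\|^{\bar E}=\sqrt{\|\mathcal{A}\,\bar{*}\,\mathcal{A}\|^E}$. Random tensors are measurable maps from a probability space into $\mathbb{T}_{N,d}$;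 expectation is entrywise; $\mathcal{O}$ is the zero tensor. *)

theory Defs
  imports "HOL-Probability.Probability" "Jordan_Normal_Form.Char_Poly"
begin

text \<open>Tensors of order N with indices in {0..<d} (0-based) are modelled as functions on
  index lists; only index lists of length N with entries below d are relevant.\<close>

type_synonym tensor = "nat list \<Rightarrow> real"

definition tidx :: "nat \<Rightarrow> nat \<Rightarrow> nat list set" where
  "tidx N d = {is. length is = N \<and> set is \<subseteq> {..<d}}"

definition half_order :: "nat \<Rightarrow> nat" where
  "half_order N = (N + 1) div 2"

definition tprod_bar :: "nat \<Rightarrow> nat \<Rightarrow> tensor \<Rightarrow> tensor \<Rightarrow> tensor" where
  "tprod_bar N d A B = (\<lambda>ij. \<Sum>ks\<in>tidx (N - half_order N) d.
      A (take (half_order N) ij @ ks) * B (drop (half_order N) ij @ ks))"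

definition tprod_under :: "nat \<Rightarrow> nat \<Rightarrow> tensor \<Rightarrow> tensor \<Rightarrow> tensor" where
  "tprod_under N d A B = (\<lambda>kk. \<Sum>is\<in>tidx (half_order N) d.
      A (is @ take (N - half_order N) kk) * B (is @ drop (N - half_order N) kk))"

text \<open>Inverse of the index map i = i_1 + sum (i_l) d^(l-1) (0-based).\<close>
definition unflat :: "nat \<Rightarrow> nat \<Rightarrow> nat \<Rightarrow> nat list" where
  "unflat p d i = map (\<lambda>l. i div d ^ l mod d) [0..<p]"

definition tunfold :: "nat \<Rightarrow> nat \<Rightarrow> tensor \<Rightarrow> real mat" where
  "tunfold p d C = mat (d ^ p) (d ^ p) (\<lambda>(i, j). C (unflat p d i @ unflat p d j))"

definition einstein_eigenvalues :: "nat \<Rightarrow> nat \<Rightarrow> tensor \<Rightarrow> real set" where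
  "einstein_eigenvalues p d C = {k. eigenvalue (tunfold p d C) k}"

text \<open>Einstein spectral norm of an Einstein-symmetric order-2p tensor.\<close>
definition enorm :: "nat \<Rightarrow> nat \<Rightarrow> tensor \<Rightarrow> real" where
  "enorm p d C = Max (abs ` einstein_eigenvalues p d C)"

definition gen_enorm :: "nat \<Rightarrow> nat \<Rightarrow> tensor \<Rightarrow> real" where
  "gen_enorm N d A = sqrt (enorm (half_order N) d (tprod_bar N d A A))"


definition tsum :: "nat \<Rightarrow> (nat \<Rightarrow> 'a \<Rightarrow> tensor) \<Rightarrow> 'a \<Rightarrow> tensor" where
  "tsum n X = (\<lambda>\<omega> is. \<Sum>k<n. X k \<omega> is)"

definition texp :: "'a measure \<Rightarrow> ('a \<Rightarrow> tensor) \<Rightarrow> tensor" where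
  "texp M T = (\<lambda>i. prob_space.expectation M (\<lambda>\<omega>. T \<omega> i))"

definition tnu :: "'a measure \<Rightarrow> nat \<Rightarrow> nat \<Rightarrow> ('a \<Rightarrow> tensor) \<Rightarrow> real" where
  "tnu M N d Y = max (enorm (half_order N) d (texp M (\<lambda>\<omega>. tprod_bar N d (Y \<omega>) (Y \<omega>))))
                     (enorm (N - half_order N) d (texp M (\<lambda>\<omega>. tprod_under N d (Y \<omega>) (Y \<omega>))))"

end

theory Submission
  imports Defs
begin

text \<open>Unfolding an order-N tensor into a \<open>d\<^sup>m \<times> d\<^sup>N\<^sup>-\<^sup>m\<close> array and passing to the self-adjoint dilation turns
  \<open>gen_enorm\<close> into the largest eigenvalue, and the two tensor products into the diagonal blocks of the
  square of the dilation, so the claim is Tropp's matrix Bernstein inequality. Its core is the bound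
  \<open>E tr exp (H + \<theta> A) \<le> tr exp (H + g E A\<^sup>2)\<close> for a centred random symmetric matrix \<open>A\<close>,
  usually taken from Lieb's concavity theorem. Here it is obtained from the convexity of the relative
  entropy \<open>tr (T ln T - T ln A)\<close>, in the form of an affine lower bound that is exact at one pair
  \<open>(T, A)\<close>: the relative entropy is an integral over \<open>r\<close> in \<open>[0, 1]\<close> of suprema of linear functions of
  \<open>(T, A)\<close>, and each of them decreases in \<open>A\<close>, so operator monotonicity of the logarithm is not
  needed.\<close>

section \<open>Matrices indexed by a finite set\<close>

text \<open>On the level of logarithms, \<open>T = exp (H + \<theta> A)\<close> satisfies
  \<open>ln T - ln (exp (\<theta> A)) = H\<close>. Hence the relative entropy of \<open>T\<close>
  with respect to \<open>exp (\<theta> A)\<close> is \<open>tr (T H)\<close>, which is linear in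
  \<open>T\<close> and can be averaged although \<open>T\<close> and \<open>A\<close> are
  correlated. After averaging, \<open>A\<close> survives only through
  \<open>E exp (\<theta> A)\<close>, which is at most \<open>exp (g V)\<close> in the order of
  quadratic forms, \<open>V\<close> being the second moment. The entropy bound obtained for
  \<open>E T\<close> becomes a trace bound by the Gibbs variational principle for
  \<open>tr exp (H + g V)\<close>. Two matrices that do not commute have different eigenbases; the
  squared inner products of the basis vectors form a doubly stochastic array, and each trace
  inequality becomes a weighted sum of scalar inequalities over pairs of eigenvalues. Matrices are
  functions on a finite set \<open>I\<close> because the dilation lives on a disjoint sum of two
  index ranges; only entries with indices in \<open>I\<close> count.\<close>

locale fin_mat =
  fixes I :: "'i set"
  assumes fin: "finite I"
begin

definition dot :: "('i \<Rightarrow> real) \<Rightarrow> ('i \<Rightarrow> real) \<Rightarrow> real" where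
  "dot v w = (\<Sum>i\<in>I. v i * w i)"

definition mv :: "('i \<Rightarrow> 'i \<Rightarrow> real) \<Rightarrow> ('i \<Rightarrow> real) \<Rightarrow> 'i \<Rightarrow> real" where
  "mv A w = (\<lambda>i. \<Sum>j\<in>I. A i j * w j)"

definition quad :: "('i \<Rightarrow> 'i \<Rightarrow> real) \<Rightarrow> ('i \<Rightarrow> real) \<Rightarrow> real" where
  "quad A w = dot w (mv A w)"

definition frob :: "('i \<Rightarrow> 'i \<Rightarrow> real) \<Rightarrow> ('i \<Rightarrow> 'i \<Rightarrow> real) \<Rightarrow> real" where
  "frob A B = (\<Sum>i\<in>I. \<Sum>j\<in>I. A i j * B i j)"

definition mtr :: "('i \<Rightarrow> 'i \<Rightarrow> real) \<Rightarrow> real" where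
  "mtr A = (\<Sum>i\<in>I. A i i)"

definition symm :: "('i \<Rightarrow> 'i \<Rightarrow> real) \<Rightarrow> bool" where
  "symm A \<longleftrightarrow> (\<forall>i\<in>I. \<forall>j\<in>I. A i j = A j i)"

definition kron :: "'i \<Rightarrow> 'i \<Rightarrow> real" where
  "kron i j = (if i = j then 1 else 0)"

definition mmul :: "('i \<Rightarrow> 'i \<Rightarrow> real) \<Rightarrow> ('i \<Rightarrow> 'i \<Rightarrow> real) \<Rightarrow> 'i \<Rightarrow> 'i \<Rightarrow> real" where
  "mmul A B = (\<lambda>i k. \<Sum>j\<in>I. A i j * B j k)"

definition orthonormal_on :: "'i set \<Rightarrow> ('i \<Rightarrow> 'i \<Rightarrow> real) \<Rightarrow> bool" where
  "orthonormal_on J u \<longleftrightarrow> (\<forall>j\<in>J. \<forall>k\<in>J. dot (u j) (u k) = kron j k)"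

text \<open>Functional calculus changes \<open>l\<close> and keeps \<open>u\<close>. The
  eigenvectors carry labels from \<open>I\<close> itself, which avoids an enumeration of
  \<open>I\<close>.\<close>

definition spec :: "('i \<Rightarrow> real) \<Rightarrow> ('i \<Rightarrow> 'i \<Rightarrow> real) \<Rightarrow> 'i \<Rightarrow> 'i \<Rightarrow> real" where
  "spec l u = (\<lambda>i k. \<Sum>j\<in>I. l j * u j i * u j k)"

definition eigdec :: "('i \<Rightarrow> 'i \<Rightarrow> real) \<Rightarrow> ('i \<Rightarrow> real) \<Rightarrow> ('i \<Rightarrow> 'i \<Rightarrow> real) \<Rightarrow> bool" where
  "eigdec A l u \<longleftrightarrow> orthonormal_on I u \<and> (\<forall>i\<in>I. \<forall>k\<in>I. A i k = spec l u i k)"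

lemma dot_commute: "dot v w = dot w v"
  by (simp add: dot_def mult.commute)

lemma dot_add_left: "dot (\<lambda>i. f i + g i) w = dot f w + dot g w"
  and dot_add_right: "dot w (\<lambda>i. f i + g i) = dot w f + dot w g"
  and dot_diff_left: "dot (\<lambda>i. f i - g i) w = dot f w - dot g w"
  and dot_diff_right: "dot w (\<lambda>i. f i - g i) = dot w f - dot w g"
  and dot_scale_left: "dot (\<lambda>i. c * f i) w = c * dot f w"
  and dot_scale_right: "dot w (\<lambda>i. c * f i) = c * dot w f"
  by (simp_all add: dot_def algebra_simps sum.distrib sum_subtractf sum_distrib_left)

lemma dot_sum_left: "dot (\<lambda>i. \<Sum>j\<in>J. f j i) w = (\<Sum>j\<in>J. dot (f j) w)"
  unfolding dot_def sum_distrib_right by (rule sum.swap)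

lemma dot_sum_right: "dot w (\<lambda>i. \<Sum>j\<in>J. f j i) = (\<Sum>j\<in>J. dot w (f j))"
  using dot_sum_left[of f J w] by (simp add: dot_commute)

lemma dot_self_nonneg: "0 \<le> dot w w"
  by (simp add: dot_def sum_nonneg)

lemma dot_self_zero: "dot w w = 0 \<longleftrightarrow> (\<forall>i\<in>I. w i = 0)"
  unfolding dot_def by (subst sum_nonneg_eq_0_iff) (auto simp: fin)

lemma dot_cong: "(\<And>i. i \<in> I \<Longrightarrow> v i = v' i) \<Longrightarrow> (\<And>i. i \<in> I \<Longrightarrow> w i = w' i) \<Longrightarrow> dot v w = dot v' w'"
  by (simp add: dot_def)

lemma sum_kron_left [simp]: "i \<in> I \<Longrightarrow> (\<Sum>j\<in>I. kron i j * f j) = f i"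
  by (simp add: kron_def if_distrib[of "\<lambda>x. x * _"] sum.delta fin cong: if_cong)

lemma sum_kron_right [simp]: "i \<in> I \<Longrightarrow> (\<Sum>j\<in>I. f j * kron j i) = f i"
  by (simp add: kron_def if_distrib[of "\<lambda>x. _ * x"] sum.delta fin cong: if_cong)

lemma kron_commute: "kron i j = kron j i"
  by (simp add: kron_def)

lemma dot_kron: "i \<in> I \<Longrightarrow> dot (kron i) w = w i"
  by (simp add: dot_def)

lemma mv_add: "mv A (\<lambda>i. f i + g i) = (\<lambda>i. mv A f i + mv A g i)"
  by (simp add: mv_def algebra_simps sum.distrib)

lemma mv_scale: "mv A (\<lambda>i. c * f i) = (\<lambda>i. c * mv A f i)"
  by (simp add: mv_def algebra_simps sum_distrib_left)

lemma dot_mv_symm: assumes "symm A" shows "dot v (mv A w) = dot (mv A v) w"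
proof -
  have "dot v (mv A w) = (\<Sum>i\<in>I. \<Sum>j\<in>I. v i * A i j * w j)"
    by (simp add: dot_def mv_def sum_distrib_left mult.assoc)
  also have "\<dots> = (\<Sum>j\<in>I. \<Sum>i\<in>I. v i * A i j * w j)" by (rule sum.swap)
  also have "\<dots> = dot (mv A v) w"
    unfolding dot_def mv_def sum_distrib_right
    using assms by (intro sum.cong refl) (auto simp: symm_def)
  finally show ?thesis .
qed

lemma quad_alt: "quad A w = (\<Sum>i\<in>I. \<Sum>j\<in>I. A i j * w i * w j)"
  by (simp add: quad_def dot_def mv_def sum_distrib_left mult_ac)

lemma quad_cong: "(\<And>i j. i \<in> I \<Longrightarrow> j \<in> I \<Longrightarrow> A i j = B i j) \<Longrightarrow> quad A w = quad B w"
  by (simp add: quad_alt)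

lemma quad_add: "quad (\<lambda>i j. A i j + B i j) w = quad A w + quad B w"
  by (simp add: quad_alt algebra_simps sum.distrib)

lemma quad_scale: "quad (\<lambda>i j. c * A i j) w = c * quad A w"
  by (simp add: quad_alt algebra_simps sum_distrib_left)

lemma quad_sum: "quad (\<lambda>i j. \<Sum>k\<in>K. A k i j) w = (\<Sum>k\<in>K. quad (A k) w)"
  by (induction K rule: infinite_finite_induct) (simp_all add: quad_add, simp_all add: quad_alt)

lemma quad_scale_vec: "quad A (\<lambda>i. c * w i) = c\<^sup>2 * quad A w"
  by (simp add: quad_def mv_scale dot_scale_left dot_scale_right power2_eq_square)

subsection \<open>Orthonormal systems and the spectral theorem\<close>

text \<open>This count replaces dimension theory: all residuals vanish if \<open>card J = card I\<close>, and some residual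
  is nonzero if \<open>card J < card I\<close>.\<close>
lemma orthonormal_residual:
  assumes J: "J \<subseteq> I" and u: "orthonormal_on J u"
  defines "p \<equiv> \<lambda>k i. kron k i - (\<Sum>j\<in>J. u j k * u j i)"
  shows "\<And>k j. k \<in> I \<Longrightarrow> j \<in> J \<Longrightarrow> dot (p k) (u j) = 0"
    and "(\<Sum>k\<in>I. dot (p k) (p k)) = real (card I) - real (card J)"
proof -
  have fJ: "finite J" using J fin finite_subset by blast
  show orth: "dot (p k) (u j) = 0" if k: "k \<in> I" and j: "j \<in> J" for k j
  proof -
    have "dot (p k) (u j) = u j k - (\<Sum>i\<in>J. u i k * dot (u i) (u j))"
      using k unfolding p_def by (simp add: dot_diff_left dot_kron dot_sum_left dot_scale_left)
    also have "(\<Sum>i\<in>J. u i k * dot (u i) (u j)) = (\<Sum>i\<in>J. if i = j then u i k else 0)"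
      using u j by (intro sum.cong) (auto simp: orthonormal_on_def kron_def)
    finally show ?thesis using j fJ by simp
  qed
  have "dot (p k) (p k) = 1 - (\<Sum>j\<in>J. u j k * u j k)" if k: "k \<in> I" for k
  proof -
    \<comment> \<open>\<open>p k\<close> is orthogonal to every \<open>u j\<close>, so expanding
      only the second factor leaves the diagonal entry \<open>p k k\<close>.\<close>
    have "dot (p k) (p k) = dot (p k) (kron k) - (\<Sum>j\<in>J. u j k * dot (p k) (u j))"
      unfolding p_def dot_diff_right[of _ "kron k"] dot_sum_right dot_scale_right by simp
    also have "\<dots> = p k k" using orth k by (simp add: dot_commute[of "p k" "kron k"] dot_kron)
    finally show ?thesis by (simp add: p_def kron_def)
  qed
  then have "(\<Sum>k\<in>I. dot (p k) (p k)) = (\<Sum>k\<in>I. 1 - (\<Sum>j\<in>J. u j k * u j k))" by simp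
  also have "\<dots> = real (card I) - (\<Sum>j\<in>J. dot (u j) (u j))"
    unfolding dot_def by (simp add: sum_subtractf) (rule sum.swap)
  also have "(\<Sum>j\<in>J. dot (u j) (u j)) = (\<Sum>j\<in>J. 1)"
    using u by (intro sum.cong) (auto simp: orthonormal_on_def kron_def)
  finally show "(\<Sum>k\<in>I. dot (p k) (p k)) = real (card I) - real (card J)" by simp
qed

text \<open>With \<open>J = I\<close> the squared residuals are nonnegative and sum to zero, so each
  \<open>kron i\<close> equals its expansion in \<open>u\<close>.\<close>

lemma orthonormal_complete:
  assumes u: "orthonormal_on I u" and i: "i \<in> I" and k: "k \<in> I"
  shows "(\<Sum>j\<in>I. u j i * u j k) = kron i k"
proof -
  define p where "p = (\<lambda>k i. kron k i - (\<Sum>j\<in>I. u j k * u j i))"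
  have "(\<Sum>k\<in>I. dot (p k) (p k)) = 0"
    using orthonormal_residual(2)[OF subset_refl u] by (simp add: p_def)
  then have "dot (p i) (p i) = 0"
    using i fin by (subst (asm) sum_nonneg_eq_0_iff) (auto simp: dot_self_nonneg)
  then show ?thesis using k by (simp add: dot_self_zero p_def)
qed

lemma parseval:
  assumes u: "orthonormal_on I u"
  shows "dot v w = (\<Sum>j\<in>I. dot (u j) v * dot (u j) w)"
proof -
  have "(\<Sum>j\<in>I. dot (u j) v * dot (u j) w)
      = (\<Sum>j\<in>I. \<Sum>i\<in>I. \<Sum>k\<in>I. (u j i * u j k) * (v i * w k))"
    by (simp add: dot_def sum_product mult_ac)
  also have "\<dots> = (\<Sum>i\<in>I. \<Sum>k\<in>I. \<Sum>j\<in>I. (u j i * u j k) * (v i * w k))"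
    by (subst sum.swap) (intro sum.cong refl sum.swap)
  also have "\<dots> = (\<Sum>i\<in>I. \<Sum>k\<in>I. kron i k * (v i * w k))"
    using orthonormal_complete[OF u] by (simp add: sum_distrib_right[symmetric])
  also have "\<dots> = dot v w"
    by (simp add: dot_def)
  finally show ?thesis by simp
qed

section \<open>Maximising a quadratic form on a unit sphere\<close>

lemma continuous_map_product_component:
  "i \<in> I \<Longrightarrow> continuous_map (product_topology (\<lambda>_. euclideanreal) I) euclideanreal (\<lambda>w. w i)"
  by (rule continuous_map_product_projection)

lemma continuous_map_dot_quad:
  shows "continuous_map (product_topology (\<lambda>_. euclideanreal) I) euclideanreal (\<lambda>w. dot w w)"
    and "continuous_map (product_topology (\<lambda>_. euclideanreal) I) euclideanreal (\<lambda>w. dot w v)"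
    and "continuous_map (product_topology (\<lambda>_. euclideanreal) I) euclideanreal (quad A)"
  unfolding dot_def quad_alt
  by (intro continuous_map_sum continuous_map_real_mult continuous_map_product_component fin
      continuous_map_const[THEN iffD2] disjI2; simp)+

text \<open>The unit vectors orthogonal to the given system form a closed subset of a compact cube
  with sides \<open>[-1, 1]\<close>, on which \<open>quad A\<close> is continuous; the residual
  count makes it nonempty. The factor \<open>dot v v\<close> extends the bound to all
  \<open>v\<close> by homogeneity.\<close>

lemma rayleigh_maximiser:
  assumes J: "J \<subseteq> I" "card J < card I" and u: "orthonormal_on J u"
  obtains w where "dot w w = 1" "\<And>j. j \<in> J \<Longrightarrow> dot w (u j) = 0"
    "\<And>v. (\<And>j. j \<in> J \<Longrightarrow> dot v (u j) = 0) \<Longrightarrow> quad A v \<le> quad A w * dot v v"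
proof -
  let ?X = "product_topology (\<lambda>_. euclideanreal) I"
  define K where "K = {w \<in> topspace ?X. dot w w \<in> {1}} \<inter> (\<Inter>j\<in>J. {w \<in> topspace ?X. dot w (u j) \<in> {0}})
      \<inter> PiE I (\<lambda>_. {-1..1})"
  have fJ: "finite J" using J fin finite_subset by blast
  have top: "topspace ?X = PiE I (\<lambda>_. UNIV)" by simp
  \<comment> \<open>Points of the product topology are extensional functions, so a normalised vector
    enters \<open>K\<close> only after restriction to \<open>I\<close>.\<close>
  have unit_in: "restrict (\<lambda>i. c * v i) I \<in> K"
    if "dot v v = d" "d > 0" "\<And>j. j \<in> J \<Longrightarrow> dot v (u j) = 0" "c = 1 / sqrt d" for v c d
  proof -
    have r: "dot (restrict (\<lambda>i. c * v i) I) x = dot (\<lambda>i. c * v i) x"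
      "dot x (restrict (\<lambda>i. c * v i) I) = dot x (\<lambda>i. c * v i)" for x
      by (auto intro!: dot_cong)
    have "c\<^sup>2 * d = 1" using that by (simp add: power_divide)
    then have 1: "dot (\<lambda>i. c * v i) (\<lambda>i. c * v i) = 1"
      using that(1) by (simp only: dot_scale_left dot_scale_right power2_eq_square mult.assoc)
    have "c * v i \<in> {-1..1}" if "i \<in> I" for i
    proof -
      have "(c * v i)\<^sup>2 \<le> dot (\<lambda>i. c * v i) (\<lambda>i. c * v i)"
        unfolding dot_def power2_eq_square
        using that fin by (intro member_le_sum) auto
      then have "\<bar>c * v i\<bar> \<le> 1" using 1 by (simp add: abs_square_le_1)
      then show ?thesis by auto
    qed
    moreover have "dot (\<lambda>i. c * v i) (u j) = 0" if "j \<in> J" for j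
      using \<open>\<And>j. j \<in> J \<Longrightarrow> dot v (u j) = 0\<close>[OF that] by (simp only: dot_scale_left)
    ultimately show ?thesis
      unfolding K_def using 1 by (auto simp only: r top) auto
  qed
  have "compactin ?X K"
    unfolding K_def
  proof (rule closed_Int_compactin)
    show "compactin ?X (PiE I (\<lambda>_. {-1..1}))"
      by (simp add: compactin_PiE)
    have "closedin ?X {w \<in> topspace ?X. dot w w \<in> {1}}"
      by (rule closedin_continuous_map_preimage[OF continuous_map_dot_quad(1)]) simp
    moreover have "closedin ?X {w \<in> topspace ?X. dot w (u j) \<in> {0}}" for j
      by (rule closedin_continuous_map_preimage[OF continuous_map_dot_quad(2)]) simp
    ultimately show "closedin ?X ({w \<in> topspace ?X. dot w w \<in> {1}} \<inter> (\<Inter>j\<in>J. {w \<in> topspace ?X. dot w (u j) \<in> {0}}))"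
      by (cases "J = {}") (auto intro!: closedin_Int closedin_Inter)
  qed
  then have comp: "compact (quad A ` K)"
    using image_compactin[OF _ continuous_map_dot_quad(3)] by (metis compactin_euclidean_iff)
  have "K \<noteq> {}"
  proof -
    define p where "p = (\<lambda>k i. kron k i - (\<Sum>j\<in>J. u j k * u j i))"
    have "(\<Sum>k\<in>I. dot (p k) (p k)) > 0"
      using orthonormal_residual(2)[OF J(1) u] J(2) by (simp add: p_def)
    then obtain k where k: "k \<in> I" "dot (p k) (p k) > 0"
      by (meson not_le sum_nonpos)
    have "\<And>j. j \<in> J \<Longrightarrow> dot (p k) (u j) = 0"
      using orthonormal_residual(1)[OF J(1) u k(1)] by (simp add: p_def)
    then show ?thesis using unit_in[of "p k"] k by blast
  qed
  then obtain w where w: "w \<in> K" and mx: "\<And>v. v \<in> K \<Longrightarrow> quad A v \<le> quad A w"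
    using compact_attains_sup[OF comp] by auto
  show ?thesis
  proof
    show "dot w w = 1" "\<And>j. j \<in> J \<Longrightarrow> dot w (u j) = 0" using w by (auto simp: K_def)
    fix v assume v: "\<And>j. j \<in> J \<Longrightarrow> dot v (u j) = 0"
    show "quad A v \<le> quad A w * dot v v"
    proof (cases "dot v v = 0")
      case True
      then have "\<forall>i\<in>I. v i = 0" by (simp add: dot_self_zero)
      then have "quad A v = 0" by (simp add: quad_alt)
      then show ?thesis using True by simp
    next
      case False
      define c where "c = 1 / sqrt (dot v v)"
      have pos: "dot v v > 0" using False dot_self_nonneg[of v] by simp
      have "quad A (restrict (\<lambda>i. c * v i) I) = quad A (\<lambda>i. c * v i)"
        by (simp add: quad_alt)
      also have "\<dots> = quad A v / dot v v"
        unfolding quad_scale_vec using pos by (simp add: c_def power_divide)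
      finally show ?thesis
        using mult_right_mono[OF mx[OF unit_in[OF refl pos v c_def]], of "dot v v"] pos by simp
    qed
  qed
qed

text \<open>The defect \<open>z = A w - c w\<close> is orthogonal to \<open>w\<close> and to the
  earlier eigenvectors, so \<open>w + e z\<close> competes in the maximisation. Its gain
  \<open>2 e |z|^2\<close> is of first order in \<open>e\<close> and all other changes are of second
  order, which forces \<open>z = 0\<close>.\<close>

lemma eigenvector_step:
  assumes A: "symm A" and J: "J \<subseteq> I" "card J < card I" and u: "orthonormal_on J u"
    and eig: "\<And>j. j \<in> J \<Longrightarrow> \<forall>i\<in>I. mv A (u j) i = l j * u j i"
  obtains w c where "dot w w = 1" "\<And>j. j \<in> J \<Longrightarrow> dot w (u j) = 0" "\<forall>i\<in>I. mv A w i = c * w i"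
proof -
  obtain w where w: "dot w w = 1" "\<And>j. j \<in> J \<Longrightarrow> dot w (u j) = 0"
    and mx: "\<And>v. (\<And>j. j \<in> J \<Longrightarrow> dot v (u j) = 0) \<Longrightarrow> quad A v \<le> quad A w * dot v v"
    by (rule rayleigh_maximiser[OF J u, of A]) blast
  define c where "c = quad A w"
  define z where "z = (\<lambda>i. mv A w i - c * w i)"
  have zu: "dot z (u j) = 0" if "j \<in> J" for j
  proof -
    have "dot (mv A w) (u j) = dot w (mv A (u j))" by (simp add: dot_mv_symm[OF A])
    also have "\<dots> = dot w (\<lambda>i. l j * u j i)" using eig that by (intro dot_cong) auto
    also have "\<dots> = 0" using w that by (simp add: dot_scale_right)
    finally show ?thesis using w that
      unfolding z_def dot_diff_left dot_scale_left by simp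
  qed
  have zw: "dot z w = 0"
    using w unfolding z_def dot_diff_left dot_scale_left
    by (simp add: c_def quad_def dot_commute[of w "mv A w"])
  have zA: "dot z (mv A w) = dot z z"
  proof -
    have "dot z (\<lambda>i. mv A w i - c * w i) = dot z (mv A w) - c * dot z w"
      by (simp only: dot_diff_right dot_scale_right)
    then show ?thesis using zw by (simp add: z_def[symmetric])
  qed
  have ineq: "2 * e * dot z z \<le> e\<^sup>2 * (c * dot z z - quad A z)" for e
  proof -
    have "quad A (\<lambda>i. w i + e * z i) = c + 2 * e * dot z z + e\<^sup>2 * quad A z"
    proof -
      have "quad A (\<lambda>i. w i + e * z i) = quad A w + e * dot w (mv A z) + e * dot z (mv A w) + e\<^sup>2 * quad A z"
        unfolding quad_def mv_add mv_scale dot_add_left dot_add_right dot_scale_left dot_scale_right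
        by (simp add: power2_eq_square algebra_simps)
      also have "dot w (mv A z) = dot z (mv A w)"
        using dot_mv_symm[OF A, of w z] dot_commute by simp
      finally show ?thesis by (simp add: zA c_def)
    qed
    moreover have "dot (\<lambda>i. w i + e * z i) (\<lambda>i. w i + e * z i) = 1 + e\<^sup>2 * dot z z"
      unfolding dot_add_left dot_add_right dot_scale_left dot_scale_right
      using w zw by (simp add: power2_eq_square algebra_simps dot_commute[of w z])
    moreover have "dot (\<lambda>i. w i + e * z i) (u j) = 0" if "j \<in> J" for j
      unfolding dot_add_left dot_scale_left using w zu that by simp
    ultimately show ?thesis
      using mx[of "\<lambda>i. w i + e * z i"] by (simp add: algebra_simps c_def)
  qed
  have "dot z z \<le> 0"
  proof (rule ccontr)
    assume "\<not> dot z z \<le> 0"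
    then have p: "dot z z > 0" by simp
    define q where "q = c * dot z z - quad A z"
    \<comment> \<open>This value makes \<open>e * (\<bar>q\<bar> + 1)\<close> equal to
      \<open>dot z z\<close>; the added 1 keeps the denominator positive.\<close>
    define e where "e = dot z z / (\<bar>q\<bar> + 1)"
    have e: "e > 0" using p by (simp add: e_def)
    have "2 * dot z z \<le> e * q"
      using ineq[of e] e by (simp add: q_def power2_eq_square)
    also have "\<dots> \<le> e * (\<bar>q\<bar> + 1)" using e by (intro mult_left_mono) auto
    also have "\<dots> = dot z z" by (simp add: e_def)
    finally show False using p by simp
  qed
  then have "\<forall>i\<in>I. z i = 0" using dot_self_nonneg[of z] dot_self_zero[of z] by linarith
  then have "\<forall>i\<in>I. mv A w i = c * w i" by (simp add: z_def)
  with w that show ?thesis by blast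
qed

text \<open>Orthonormal eigenvectors are collected one by one under labels from \<open>I\<close>.
  Once there are \<open>card I\<close> of them every label is used, and completeness expands
  \<open>A\<close> in them.\<close>

theorem spectral_theorem:
  assumes A: "symm A"
  obtains l u where "eigdec A l u"
proof -
  have "\<exists>J u l. J \<subseteq> I \<and> card J = k \<and> orthonormal_on J u \<and> (\<forall>j\<in>J. \<forall>i\<in>I. mv A (u j) i = l j * u j i)"
    if "k \<le> card I" for k
    using that
  proof (induction k)
    case 0
    show ?case by (rule exI[of _ "{}"]) (simp add: orthonormal_on_def)
  next
    case (Suc k)
    from Suc.IH[OF Suc_leD[OF Suc.prems]]
    obtain J u l where J: "J \<subseteq> I" "card J = k" and u: "orthonormal_on J u"
      and eig: "\<And>j. j \<in> J \<Longrightarrow> \<forall>i\<in>I. mv A (u j) i = l j * u j i" by blast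
    obtain w c where w: "dot w w = 1" "\<And>j. j \<in> J \<Longrightarrow> dot w (u j) = 0" "\<forall>i\<in>I. mv A w i = c * w i"
      using eigenvector_step[OF A J(1) _ u eig] J Suc.prems by auto
    have "J \<noteq> I" using J Suc.prems by auto
    then obtain x where x: "x \<in> I" "x \<notin> J" using J by blast
    have fJ: "finite J" using J fin finite_subset by blast
    have "orthonormal_on (insert x J) (u(x := w))"
      using u w x by (auto simp: orthonormal_on_def kron_def) (metis dot_commute)
    moreover have "\<forall>j\<in>insert x J. \<forall>i\<in>I. mv A ((u(x := w)) j) i = (l(x := c)) j * (u(x := w)) j i"
      using eig w x by auto
    moreover have "insert x J \<subseteq> I" "card (insert x J) = Suc k" using J x fJ by auto
    ultimately show ?case by blast
  qed
  from this[OF le_refl] obtain J u l where "J \<subseteq> I" "card J = card I" and u: "orthonormal_on J u"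
    and eig: "\<And>j. j \<in> J \<Longrightarrow> \<forall>i\<in>I. mv A (u j) i = l j * u j i" by blast
  then have J: "J = I" using card_subset_eq[OF fin] by blast
  have "A i k = spec l u i k" if i: "i \<in> I" and k: "k \<in> I" for i k
  proof -
    have "A i k = (\<Sum>m\<in>I. A i m * kron m k)" using k by simp
    also have "\<dots> = (\<Sum>m\<in>I. \<Sum>j\<in>I. A i m * u j m * u j k)"
      using orthonormal_complete[of u] u J k
      by (intro sum.cong refl) (simp add: sum_distrib_left[symmetric] mult.assoc)
    also have "\<dots> = (\<Sum>j\<in>I. mv A (u j) i * u j k)"
      by (subst sum.swap) (simp add: mv_def sum_distrib_right)
    also have "\<dots> = spec l u i k" using eig i J by (simp add: spec_def)
    finally show ?thesis .
  qed
  then show ?thesis using that[of l u] u J by (simp add: eigdec_def)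
qed

end

lemma sum_rotate3:
  "(\<Sum>i\<in>A. \<Sum>j\<in>B. \<Sum>k\<in>C. f i j k) = (\<Sum>k\<in>C. \<Sum>i\<in>A. \<Sum>j\<in>B. f i j k)"
proof -
  have "(\<Sum>i\<in>A. \<Sum>j\<in>B. \<Sum>k\<in>C. f i j k) = (\<Sum>i\<in>A. \<Sum>k\<in>C. \<Sum>j\<in>B. f i j k)"
    by (intro sum.cong refl sum.swap)
  also have "\<dots> = (\<Sum>k\<in>C. \<Sum>i\<in>A. \<Sum>j\<in>B. f i j k)"
    by (rule sum.swap)
  finally show ?thesis .
qed

context fin_mat
begin

subsection \<open>Functional calculus\<close>

primrec mpow :: "('i \<Rightarrow> 'i \<Rightarrow> real) \<Rightarrow> nat \<Rightarrow> 'i \<Rightarrow> 'i \<Rightarrow> real" where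
  "mpow A 0 = kron"
| "mpow A (Suc p) = mmul A (mpow A p)"

text \<open>The power series makes measurability in the entries immediate; a definition through
  \<open>eigdec\<close> would call for a measurable choice of eigenvectors.\<close>

definition mexp :: "('i \<Rightarrow> 'i \<Rightarrow> real) \<Rightarrow> 'i \<Rightarrow> 'i \<Rightarrow> real" where
  "mexp A = (\<lambda>i k. \<Sum>p. mpow A p i k / fact p)"

lemma eigdecD: "eigdec A l u \<Longrightarrow> orthonormal_on I u"
  "eigdec A l u \<Longrightarrow> i \<in> I \<Longrightarrow> k \<in> I \<Longrightarrow> A i k = spec l u i k"
  by (auto simp: eigdec_def)

lemma orthonormalD: "orthonormal_on I u \<Longrightarrow> j \<in> I \<Longrightarrow> k \<in> I \<Longrightarrow> dot (u j) (u k) = kron j k"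
  by (auto simp: orthonormal_on_def)

lemma symm_spec: "symm (spec l u)"
  by (simp add: symm_def spec_def mult_ac)

lemma mmul_spec:
  assumes "orthonormal_on I u"
  shows "mmul (spec f u) (spec g u) = spec (\<lambda>j. f j * g j) u"
proof (intro ext)
  fix i k
  have "mmul (spec f u) (spec g u) i k
      = (\<Sum>m\<in>I. \<Sum>j\<in>I. \<Sum>n\<in>I. f j * u j i * g n * u n k * (u j m * u n m))"
    by (simp add: mmul_def spec_def sum_product mult_ac)
  also have "\<dots> = (\<Sum>j\<in>I. \<Sum>n\<in>I. \<Sum>m\<in>I. f j * u j i * g n * u n k * (u j m * u n m))"
    by (subst sum.swap) (intro sum.cong refl sum.swap)
  also have "\<dots> = (\<Sum>j\<in>I. \<Sum>n\<in>I. f j * u j i * g n * u n k * dot (u j) (u n))"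
    by (simp add: dot_def sum_distrib_left)
  also have "\<dots> = (\<Sum>j\<in>I. \<Sum>n\<in>I. kron j n * (f j * u j i * g n * u n k))"
    using assms by (intro sum.cong refl) (simp add: orthonormalD)
  also have "\<dots> = (\<Sum>j\<in>I. f j * u j i * g j * u j k)"
    by simp
  also have "\<dots> = spec (\<lambda>j. f j * g j) u i k"
    by (simp add: spec_def mult_ac)
  finally show "mmul (spec f u) (spec g u) i k = spec (\<lambda>j. f j * g j) u i k" .
qed

lemma mmul_cong: "(\<And>i j. i \<in> I \<Longrightarrow> j \<in> I \<Longrightarrow> A i j = A' i j) \<Longrightarrow> (\<And>i j. i \<in> I \<Longrightarrow> j \<in> I \<Longrightarrow> B i j = B' i j)
    \<Longrightarrow> i \<in> I \<Longrightarrow> k \<in> I \<Longrightarrow> mmul A B i k = mmul A' B' i k"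
  by (simp add: mmul_def)

lemma mpow_spec:
  assumes A: "eigdec A l u" and "i \<in> I" "k \<in> I"
  shows "mpow A p i k = spec (\<lambda>j. l j ^ p) u i k"
  using assms(2,3)
proof (induction p arbitrary: i k)
  case 0
  then show ?case using orthonormal_complete[OF eigdecD(1)[OF A]] by (simp add: spec_def)
next
  case (Suc p)
  have "mpow A (Suc p) i k = mmul (spec l u) (spec (\<lambda>j. l j ^ p) u) i k"
    unfolding mpow.simps using Suc A by (intro mmul_cong) (auto simp: eigdecD(2))
  then show ?case by (simp add: mmul_spec[OF eigdecD(1)[OF A]])
qed

lemma mexp_spec:
  assumes A: "eigdec A l u" and ik: "i \<in> I" "k \<in> I"
  shows "mexp A i k = spec (\<lambda>j. exp (l j)) u i k"
proof -
  have "(\<lambda>p. \<Sum>j\<in>I. (l j ^ p / fact p) * (u j i * u j k)) sums (\<Sum>j\<in>I. exp (l j) * (u j i * u j k))"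
    using exp_converges[where 'a = real]
    by (intro sums_sum sums_mult2) (simp add: divide_inverse mult.commute scaleR_conv_of_real)
  also have "(\<lambda>p. \<Sum>j\<in>I. (l j ^ p / fact p) * (u j i * u j k)) = (\<lambda>p. mpow A p i k / fact p)"
    by (simp add: mpow_spec[OF A ik] spec_def sum_divide_distrib mult.assoc)
  finally show ?thesis
    unfolding mexp_def spec_def by (simp add: sums_iff mult.assoc)
qed

lemma quad_spec: "quad (spec f u) w = (\<Sum>j\<in>I. f j * (dot (u j) w)\<^sup>2)"
proof -
  have "quad (spec f u) w = (\<Sum>i\<in>I. \<Sum>k\<in>I. \<Sum>j\<in>I. f j * ((u j i * w i) * (u j k * w k)))"
    unfolding quad_alt spec_def sum_distrib_right by (intro sum.cong refl) (simp add: mult_ac)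
  also have "\<dots> = (\<Sum>j\<in>I. \<Sum>i\<in>I. \<Sum>k\<in>I. f j * ((u j i * w i) * (u j k * w k)))"
    by (rule sum_rotate3)
  also have "\<dots> = (\<Sum>j\<in>I. f j * (dot (u j) w)\<^sup>2)"
    unfolding dot_def power2_eq_square sum_product by (simp add: sum_distrib_left)
  finally show ?thesis .
qed

lemma mtr_spec:
  assumes "orthonormal_on I u" shows "mtr (spec f u) = (\<Sum>j\<in>I. f j)"
proof -
  have "mtr (spec f u) = (\<Sum>j\<in>I. f j * dot (u j) (u j))"
    unfolding mtr_def spec_def dot_def by (subst sum.swap) (simp add: sum_distrib_left mult.assoc)
  then show ?thesis using assms by (simp add: orthonormalD kron_def)
qed

lemma frob_spec: "frob B (spec f u) = (\<Sum>j\<in>I. f j * quad B (u j))"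
proof -
  have "frob B (spec f u) = (\<Sum>i\<in>I. \<Sum>k\<in>I. \<Sum>j\<in>I. f j * (B i k * u j i * u j k))"
    by (simp add: frob_def spec_def sum_distrib_left mult_ac)
  also have "\<dots> = (\<Sum>i\<in>I. \<Sum>j\<in>I. \<Sum>k\<in>I. f j * (B i k * u j i * u j k))"
    by (intro sum.cong refl sum.swap)
  also have "\<dots> = (\<Sum>j\<in>I. \<Sum>i\<in>I. \<Sum>k\<in>I. f j * (B i k * u j i * u j k))"
    by (rule sum.swap)
  finally show ?thesis by (simp add: quad_alt sum_distrib_left)
qed

lemma frob_spec_spec: "frob (spec f u) (spec g v) = (\<Sum>i\<in>I. \<Sum>j\<in>I. (dot (u i) (v j))\<^sup>2 * (f i * g j))"
  unfolding frob_spec quad_spec sum_distrib_left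
  by (subst sum.swap) (simp add: mult_ac)

lemma frob_cong: "(\<And>i j. i \<in> I \<Longrightarrow> j \<in> I \<Longrightarrow> A i j = A' i j) \<Longrightarrow> (\<And>i j. i \<in> I \<Longrightarrow> j \<in> I \<Longrightarrow> B i j = B' i j)
    \<Longrightarrow> frob A B = frob A' B'"
  by (simp add: frob_def)

lemma frob_add_right: "frob B (\<lambda>i j. A i j + C i j) = frob B A + frob B C"
  and frob_diff_right: "frob B (\<lambda>i j. A i j - C i j) = frob B A - frob B C"
  by (simp_all add: frob_def algebra_simps sum.distrib sum_subtractf sum_distrib_left)

lemma quad_bounded:
  assumes "eigdec A l u" and "\<And>j. j \<in> I \<Longrightarrow> l j \<le> c"
  shows "quad A w \<le> c * dot w w"
proof -
  have "quad A w = (\<Sum>j\<in>I. l j * (dot (u j) w)\<^sup>2)"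
    unfolding quad_spec[symmetric] using assms(1) by (intro quad_cong eigdecD(2))
  also have "\<dots> \<le> (\<Sum>j\<in>I. c * (dot (u j) w)\<^sup>2)"
    using assms(2) by (intro sum_mono mult_right_mono) auto
  also have "\<dots> = c * dot w w"
    using parseval[OF eigdecD(1)[OF assms(1)], of w w] by (simp add: sum_distrib_left power2_eq_square)
  finally show ?thesis .
qed

lemma quad_eigenvector:
  assumes "eigdec A l u" and j: "j \<in> I"
  shows "quad A (u j) = l j"
proof -
  have "quad A (u j) = (\<Sum>k\<in>I. l k * (dot (u k) (u j))\<^sup>2)"
    unfolding quad_spec[symmetric] using assms(1) by (intro quad_cong eigdecD(2))
  also have "\<dots> = (\<Sum>k\<in>I. l k * kron k j)"
    using orthonormalD[OF eigdecD(1)[OF assms(1)]] j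
    by (intro sum.cong) (auto simp: kron_def)
  finally show ?thesis using j by simp
qed

lemma eigenvalue_bounds:
  assumes "eigdec A l u" "j \<in> I" "\<And>w. \<bar>quad A w\<bar> \<le> c * dot w w"
  shows "\<bar>l j\<bar> \<le> c"
  using assms(3)[of "u j"] quad_eigenvector[OF assms(1,2)] orthonormalD[OF eigdecD(1)[OF assms(1)] assms(2,2)]
  by (simp add: kron_def)

lemma eigdec_exp: "eigdec A l u \<Longrightarrow> eigdec (mexp A) (\<lambda>j. exp (l j)) u"
  using mexp_spec by (auto simp: eigdec_def)

lemma mtr_mexp:
  assumes "eigdec A l u" shows "mtr (mexp A) = (\<Sum>j\<in>I. exp (l j))"
proof -
  have "mtr (mexp A) = mtr (spec (\<lambda>j. exp (l j)) u)"
    using assms by (simp add: mtr_def mexp_spec)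
  then show ?thesis using mtr_spec eigdecD(1)[OF assms] by simp
qed

lemma symm_mexp: "symm A \<Longrightarrow> symm (mexp A)"
  by (metis eigdec_exp spectral_theorem eigdec_def symm_def symm_spec)

subsection \<open>The tangent inequality for the relative entropy\<close>

text \<open>For \<open>r < 1\<close> and \<open>Z = 1 + (1 - r) W\<close>, the number \<open>frob (tanP r W) T - frob (tanQ r W) A\<close> is
  \<open>(2 \<langle>Z, T\<rangle> - (1 - r) \<langle>Z, A Z\<rangle> - r \<langle>Z, Z T\<rangle> - tr T) / (1 - r)\<close>; written in terms of \<open>W\<close> it is
  regular at \<open>r = 1\<close>. Integrating its supremum over \<open>W\<close> for \<open>r\<close> from 0 to 1 gives
  \<open>tr (T ln T - T ln A)\<close>.\<close>
definition tanP :: "real \<Rightarrow> ('i \<Rightarrow> 'i \<Rightarrow> real) \<Rightarrow> 'i \<Rightarrow> 'i \<Rightarrow> real" where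
  "tanP r W = (\<lambda>k l. kron k l + (1 - r) * (2 * W k l - r * (\<Sum>m\<in>I. W m k * W m l)))"

definition tanZ :: "real \<Rightarrow> ('i \<Rightarrow> 'i \<Rightarrow> real) \<Rightarrow> 'i \<Rightarrow> 'i \<Rightarrow> real" where
  "tanZ r W = (\<lambda>k l. kron k l + (1 - r) * W k l)"

definition tanQ :: "real \<Rightarrow> ('i \<Rightarrow> 'i \<Rightarrow> real) \<Rightarrow> 'i \<Rightarrow> 'i \<Rightarrow> real" where
  "tanQ r W = (\<lambda>k l. \<Sum>m\<in>I. tanZ r W k m * tanZ r W l m)"

lemma quad_gram: "quad (\<lambda>k l. \<Sum>m\<in>I. Z m k * Z m l) x = dot (mv Z x) (mv Z x)"
proof -
  have "quad (\<lambda>k l. \<Sum>m\<in>I. Z m k * Z m l) x = (\<Sum>k\<in>I. \<Sum>l\<in>I. \<Sum>m\<in>I. (Z m k * x k) * (Z m l * x l))"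
    unfolding quad_alt sum_distrib_right by (intro sum.cong refl) (simp add: mult_ac)
  also have "\<dots> = (\<Sum>m\<in>I. \<Sum>k\<in>I. \<Sum>l\<in>I. (Z m k * x k) * (Z m l * x l))"
    by (rule sum_rotate3)
  finally show ?thesis by (simp add: dot_def mv_def sum_product)
qed

lemma dot_mv_transpose: "dot (mv (\<lambda>k l. Z l k) x) y = dot x (mv Z y)"
  unfolding dot_def mv_def sum_distrib_left sum_distrib_right
  by (subst sum.swap) (simp add: mult_ac)

text \<open>\<open>A\<close> acts on \<open>W\<close> from the left and \<open>T\<close> from the
  right. In the mixed coordinates \<open>x = dot (u i) (mv W (v j))\<close> the quadratic form is
  therefore diagonal, and each pair \<open>i\<close>, \<open>j\<close> can be optimised
  separately.\<close>

lemma frob_tangent: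
  assumes u: "orthonormal_on I u" and v: "orthonormal_on I v"
  shows "frob (tanP r W) (spec t v) - frob (tanQ r W) (spec a u)
    = (\<Sum>i\<in>I. \<Sum>j\<in>I. let c = dot (u i) (v j); x = dot (u i) (mv W (v j)) in
        t j * c\<^sup>2 + (1 - r) * (2 * t j * c * x - r * t j * x\<^sup>2) - a i * (c + (1 - r) * x)\<^sup>2)"
proof -
  have mvk: "mv kron x k = x k" if "k \<in> I" for x k
    using that by (simp add: mv_def)
  have qk: "quad kron x = dot x x" for x
    unfolding quad_def using mvk by (intro dot_cong) auto
  have P: "quad (tanP r W) (v j) = (\<Sum>i\<in>I. let c = dot (u i) (v j); x = dot (u i) (mv W (v j)) in
        c\<^sup>2 + (1 - r) * (2 * c * x - r * x\<^sup>2))" if j: "j \<in> I" for j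
  proof -
    have "quad (tanP r W) (v j) = quad (\<lambda>k l. kron k l + ((2 * (1 - r)) * W k l
        + (- (1 - r) * r) * (\<Sum>m\<in>I. W m k * W m l))) (v j)"
      by (simp add: tanP_def algebra_simps)
    also have "\<dots> = dot (v j) (v j) + (2 * (1 - r) * dot (v j) (mv W (v j))
        + (- (1 - r) * r) * dot (mv W (v j)) (mv W (v j)))"
      unfolding quad_add quad_scale qk quad_gram by (simp only: quad_def)
    also have "\<dots> = (\<Sum>i\<in>I. let c = dot (u i) (v j); x = dot (u i) (mv W (v j)) in
        c\<^sup>2 + (1 - r) * (2 * c * x - r * x\<^sup>2))"
      unfolding parseval[OF u, of "v j" "v j"] parseval[OF u, of "v j" "mv W (v j)"]
        parseval[OF u, of "mv W (v j)" "mv W (v j)"] sum_distrib_left sum.distrib[symmetric] Let_def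
      by (intro sum.cong) (auto simp: algebra_simps power2_eq_square)
    finally show ?thesis .
  qed
  have Q: "quad (tanQ r W) (u i) = (\<Sum>j\<in>I. (dot (u i) (v j) + (1 - r) * dot (u i) (mv W (v j)))\<^sup>2)"
    if i: "i \<in> I" for i
  proof -
    have Z: "dot x (mv (tanZ r W) y) = dot x y + (1 - r) * dot x (mv W y)" for x y
    proof -
      have "mv (tanZ r W) y k = mv kron y k + (1 - r) * mv W y k" for k
        by (simp add: tanZ_def mv_def distrib_right sum.distrib sum_distrib_left mult.assoc)
      then have "dot x (mv (tanZ r W) y) = dot x (\<lambda>k. y k + (1 - r) * mv W y k)"
        using mvk by (intro dot_cong) auto
      then show ?thesis by (simp only: dot_add_right dot_scale_right)
    qed
    have "quad (tanQ r W) (u i) = dot (mv (\<lambda>m k. tanZ r W k m) (u i)) (mv (\<lambda>m k. tanZ r W k m) (u i))"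
      unfolding tanQ_def by (rule quad_gram)
    also have "\<dots> = (\<Sum>j\<in>I. (dot (u i) (mv (tanZ r W) (v j)))\<^sup>2)"
      by (subst parseval[OF v])
        (simp add: dot_commute[of "v _" "mv _ _"] dot_mv_transpose power2_eq_square)
    finally show ?thesis by (simp add: Z)
  qed
  have "frob (tanP r W) (spec t v) = (\<Sum>i\<in>I. \<Sum>j\<in>I. t j * (let c = dot (u i) (v j); x = dot (u i) (mv W (v j)) in
        c\<^sup>2 + (1 - r) * (2 * c * x - r * x\<^sup>2)))"
    unfolding frob_spec by (subst sum.swap) (simp add: P sum_distrib_left)
  moreover have "frob (tanQ r W) (spec a u)
      = (\<Sum>i\<in>I. \<Sum>j\<in>I. a i * (dot (u i) (v j) + (1 - r) * dot (u i) (mv W (v j)))\<^sup>2)"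
    unfolding frob_spec by (simp add: Q sum_distrib_left)
  ultimately show ?thesis
    by (simp only: sum_subtractf[symmetric] Let_def) (intro sum.cong refl, simp add: algebra_simps)
qed

end

text \<open>Completing the square in \<open>x\<close>; the maximiser is \<open>x = c * (t - a) / ((1 - r) * a + r * t)\<close>.\<close>
lemma tangent_scalar:
  fixes a t r c x :: real
  assumes "a > 0" "t > 0" "0 \<le> r" "r \<le> 1"
  defines "M \<equiv> (1 - r) * a + r * t"
  shows "t * c\<^sup>2 + (1 - r) * (2 * t * c * x - r * t * x\<^sup>2) - a * (c + (1 - r) * x)\<^sup>2
    = c\<^sup>2 * (t * (t - a) / M) - (1 - r) * M * (x - c * (t - a) / M)\<^sup>2"
    and "M > 0"
proof -
  show M: "M > 0"
  proof (cases "r = 0")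
    case False
    then have "r * t > 0" "(1 - r) * a \<ge> 0" using assms by auto
    then show ?thesis by (simp add: M_def)
  qed (simp add: M_def assms)
  have "(1 - r) * M * (x - c * (t - a) / M)\<^sup>2
      = (1 - r) * M * x\<^sup>2 - 2 * (1 - r) * x * c * (t - a) + (1 - r) * c\<^sup>2 * (t - a)\<^sup>2 / M"
    using M by (simp add: power2_eq_square field_simps)
  moreover have "c\<^sup>2 * (t * (t - a) / M) = c\<^sup>2 * (t - a) + (1 - r) * c\<^sup>2 * (t - a)\<^sup>2 / M"
  proof -
    \<comment> \<open>This splitting separates \<open>c\<^sup>2 * (t - a)\<close>, the value at
      \<open>x = 0\<close>, from the gain of the optimal \<open>x\<close>.\<close>
    have "t = M + (1 - r) * (t - a)" by (simp add: M_def algebra_simps)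
    then have "t / M = 1 + (1 - r) * (t - a) / M" using M
      by (metis add_divide_distrib divide_self less_numeral_extra(3))
    then have "c\<^sup>2 * (t - a) * (t / M) = c\<^sup>2 * (t - a) * (1 + (1 - r) * (t - a) / M)" by simp
    also have "\<dots> = c\<^sup>2 * (t - a) + (1 - r) * c\<^sup>2 * (t - a)\<^sup>2 / M"
      unfolding distrib_left by (simp add: power2_eq_square mult_ac)
    finally show ?thesis by (simp add: mult_ac)
  qed
  moreover have "t * c\<^sup>2 + (1 - r) * (2 * t * c * x - r * t * x\<^sup>2) - a * (c + (1 - r) * x)\<^sup>2
      = c\<^sup>2 * (t - a) + 2 * (1 - r) * x * c * (t - a) - (1 - r) * M * x\<^sup>2"
    by (simp add: M_def power2_eq_square algebra_simps)
  ultimately show "t * c\<^sup>2 + (1 - r) * (2 * t * c * x - r * t * x\<^sup>2) - a * (c + (1 - r) * x)\<^sup>2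
    = c\<^sup>2 * (t * (t - a) / M) - (1 - r) * M * (x - c * (t - a) / M)\<^sup>2"
    by simp
qed

text \<open>A primitive is \<open>t * ln ((1 - r) * a + r * t)\<close>. The integrand is the maximum
  over \<open>x\<close> from \<open>tangent_scalar\<close> with \<open>c = 1\<close>, so the
  logarithm arises only on integration.\<close>

lemma log_ratio_has_integral:
  fixes a t :: real
  assumes "a > 0" "t > 0"
  shows "((\<lambda>r. t * (t - a) / ((1 - r) * a + r * t)) has_integral t * (ln t - ln a)) {0..1}"
proof -
  have "((\<lambda>r. t * (t - a) / ((1 - r) * a + r * t)) has_integral
      t * ln ((1 - 1) * a + 1 * t) - t * ln ((1 - 0) * a + 0 * t)) {0..1}"
  proof (rule fundamental_theorem_of_calculus)
    fix r :: real assume "r \<in> {0..1}"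
    then have "(1 - r) * a + r * t > 0" using tangent_scalar(2)[of a t r] assms by auto
    then show "((\<lambda>r. t * ln ((1 - r) * a + r * t)) has_vector_derivative
        t * (t - a) / ((1 - r) * a + r * t)) (at r within {0..1})"
      unfolding has_real_derivative_iff_has_vector_derivative[symmetric]
      by (auto intro!: derivative_eq_intros simp: field_simps)
  qed simp
  then show ?thesis by (simp add: algebra_simps)
qed

context fin_mat
begin

lemma relative_entropy_tangent:
  assumes z: "orthonormal_on I z" and w: "orthonormal_on I w"
    and b: "\<And>i. i \<in> I \<Longrightarrow> b i > 0" and s: "\<And>i. i \<in> I \<Longrightarrow> s i > 0"
  obtains P Q where
    "\<And>u v a t. \<lbrakk>orthonormal_on I u; orthonormal_on I v; \<And>i. i \<in> I \<Longrightarrow> a i > 0; \<And>i. i \<in> I \<Longrightarrow> t i > 0\<rbrakk> \<Longrightarrow>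
       frob P (spec t v) - frob Q (spec a u) \<le> (\<Sum>i\<in>I. \<Sum>j\<in>I. (dot (u i) (v j))\<^sup>2 * (t j * (ln (t j) - ln (a i))))"
    "frob P (spec s w) - frob Q (spec b z) = (\<Sum>i\<in>I. \<Sum>j\<in>I. (dot (z i) (w j))\<^sup>2 * (s j * (ln (s j) - ln (b i))))"
    "\<And>C. (\<And>x. quad C x \<ge> 0) \<Longrightarrow> frob Q C \<ge> 0"
proof -
  \<comment> \<open>The optimal coefficients from \<open>tangent_scalar\<close>; \<open>W r\<close>
    is the matrix whose entry between \<open>z i\<close> and \<open>w j\<close> is
    \<open>x r i j\<close>.\<close>
  define x where "x = (\<lambda>r i j. dot (z i) (w j) * (s j - b i) / ((1 - r) * b i + r * s j))"
  define W where "W = (\<lambda>r k l. \<Sum>i\<in>I. \<Sum>j\<in>I. x r i j * z i k * w j l)"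
  define P where "P = (\<lambda>k l. integral {0..1} (\<lambda>r. tanP r (W r) k l))"
  define Q where "Q = (\<lambda>k l. integral {0..1} (\<lambda>r. tanQ r (W r) k l))"
  \<comment> \<open>The denominators do not vanish on the closed interval, so the entries of
    \<open>W r\<close> are continuous in \<open>r\<close> and the entrywise integrals exist.\<close>
  have M: "(1 - r) * b i + r * s j \<noteq> 0" if "r \<in> {0..1}" "i \<in> I" "j \<in> I" for r i j
    using tangent_scalar(2)[of "b i" "s j" r] that b s by fastforce
  have cW: "continuous_on {0..1} (\<lambda>r. W r k l)" for k l
    unfolding W_def x_def using M by (intro continuous_intros) auto
  have iP: "(\<lambda>r. tanP r (W r) k l) integrable_on {0..1}" for k l
    unfolding tanP_def by (intro integrable_continuous_real continuous_intros cW)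
  have iQ: "(\<lambda>r. tanQ r (W r) k l) integrable_on {0..1}" for k l
    unfolding tanQ_def tanZ_def by (intro integrable_continuous_real continuous_intros cW)
  have hP: "((\<lambda>r. frob (tanP r (W r)) T) has_integral frob P T) {0..1}" for T
    unfolding frob_def P_def
    by (intro has_integral_sum fin has_integral_mult_left integrable_integral iP)
  have hQ: "((\<lambda>r. frob (tanQ r (W r)) T) has_integral frob Q T) {0..1}" for T
    unfolding frob_def Q_def
    by (intro has_integral_sum fin has_integral_mult_left integrable_integral iQ)
  have hR: "((\<lambda>r. \<Sum>i\<in>I. \<Sum>j\<in>I. (dot (u i) (v j))\<^sup>2 * (t j * (t j - a i) / ((1 - r) * a i + r * t j)))
      has_integral (\<Sum>i\<in>I. \<Sum>j\<in>I. (dot (u i) (v j))\<^sup>2 * (t j * (ln (t j) - ln (a i))))) {0..1}"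
    if "\<And>i. i \<in> I \<Longrightarrow> a i > 0" "\<And>i. i \<in> I \<Longrightarrow> t i > 0" for u v :: "'i \<Rightarrow> 'i \<Rightarrow> real" and a t
    by (intro has_integral_sum fin has_integral_mult_right log_ratio_has_integral that)
  show ?thesis
  proof
    fix u v :: "'i \<Rightarrow> 'i \<Rightarrow> real" and a t :: "'i \<Rightarrow> real"
    assume uv: "orthonormal_on I u" "orthonormal_on I v"
      and pos: "\<And>i. i \<in> I \<Longrightarrow> a i > 0" "\<And>i. i \<in> I \<Longrightarrow> t i > 0"
    show "frob P (spec t v) - frob Q (spec a u) \<le> (\<Sum>i\<in>I. \<Sum>j\<in>I. (dot (u i) (v j))\<^sup>2 * (t j * (ln (t j) - ln (a i))))"
    proof (rule has_integral_le[OF has_integral_diff[OF hP hQ] hR[OF pos]])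
      fix r :: real assume r: "r \<in> {0..1}"
      show "frob (tanP r (W r)) (spec t v) - frob (tanQ r (W r)) (spec a u)
        \<le> (\<Sum>i\<in>I. \<Sum>j\<in>I. (dot (u i) (v j))\<^sup>2 * (t j * (t j - a i) / ((1 - r) * a i + r * t j)))"
        unfolding frob_tangent[OF uv] Let_def
      proof (intro sum_mono)
        fix i j assume ij: "i \<in> I" "j \<in> I"
        note sc = tangent_scalar[of "a i" "t j" r]
        have "(1 - r) * ((1 - r) * a i + r * t j) * y\<^sup>2 \<ge> 0" for y
          using sc(2) r pos ij by (intro mult_nonneg_nonneg) auto
        then show "t j * (dot (u i) (v j))\<^sup>2 + (1 - r) * (2 * t j * dot (u i) (v j) * dot (u i) (mv (W r) (v j))
            - r * t j * (dot (u i) (mv (W r) (v j)))\<^sup>2) - a i * (dot (u i) (v j) + (1 - r) * dot (u i) (mv (W r) (v j)))\<^sup>2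
          \<le> (dot (u i) (v j))\<^sup>2 * (t j * (t j - a i) / ((1 - r) * a i + r * t j))"
          using sc(1) r pos ij by simp
      qed
    qed
  next
    show "frob P (spec s w) - frob Q (spec b z) = (\<Sum>i\<in>I. \<Sum>j\<in>I. (dot (z i) (w j))\<^sup>2 * (s j * (ln (s j) - ln (b i))))"
    proof (rule has_integral_unique[OF has_integral_diff[OF hP hQ]])
      show "((\<lambda>r. frob (tanP r (W r)) (spec s w) - frob (tanQ r (W r)) (spec b z)) has_integral
        (\<Sum>i\<in>I. \<Sum>j\<in>I. (dot (z i) (w j))\<^sup>2 * (s j * (ln (s j) - ln (b i))))) {0..1}"
      proof (rule has_integral_eq[OF _ hR[OF b s]])
        fix r :: real assume r: "r \<in> {0..1}"
        \<comment> \<open>Orthonormality of both bases recovers the chosen coefficient, and the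
          square in \<open>tangent_scalar\<close> vanishes.\<close>
        have Wx: "dot (z i) (mv (W r) (w j)) = x r i j" if ij: "i \<in> I" "j \<in> I" for i j
        proof -
          have "mv (W r) (w j) k = (\<Sum>i'\<in>I. \<Sum>j'\<in>I. x r i' j' * dot (w j') (w j) * z i' k)" for k
            unfolding mv_def W_def dot_def sum_distrib_right sum_distrib_left
            by (subst sum_rotate3[symmetric], intro sum.cong refl) (simp add: mult_ac)
          also have "\<dots> k = (\<Sum>i'\<in>I. \<Sum>j'\<in>I. kron j' j * (x r i' j' * z i' k))" for k
            using ij w by (intro sum.cong refl) (simp add: orthonormalD)
          also have "\<dots> k = (\<Sum>i'\<in>I. x r i' j * z i' k)" for k
            using ij by (simp add: kron_commute[of _ j])
          finally have "mv (W r) (w j) = (\<lambda>k. \<Sum>i'\<in>I. x r i' j * z i' k)" by blast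
          then have "dot (z i) (mv (W r) (w j)) = (\<Sum>i'\<in>I. x r i' j * dot (z i) (z i'))"
            by (simp only: dot_sum_right dot_scale_right)
          also have "\<dots> = (\<Sum>i'\<in>I. x r i' j * kron i' i)"
            using ij z by (intro sum.cong refl) (simp add: orthonormalD kron_commute)
          finally show ?thesis using ij by simp
        qed
        show "(\<Sum>i\<in>I. \<Sum>j\<in>I. (dot (z i) (w j))\<^sup>2 * (s j * (s j - b i) / ((1 - r) * b i + r * s j)))
          = frob (tanP r (W r)) (spec s w) - frob (tanQ r (W r)) (spec b z)"
          unfolding frob_tangent[OF z w] Let_def
        proof (intro sum.cong refl)
          fix i j assume ij: "i \<in> I" "j \<in> I"
          show "(dot (z i) (w j))\<^sup>2 * (s j * (s j - b i) / ((1 - r) * b i + r * s j)) =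
            s j * (dot (z i) (w j))\<^sup>2 + (1 - r) * (2 * s j * dot (z i) (w j) * dot (z i) (mv (W r) (w j))
            - r * s j * (dot (z i) (mv (W r) (w j)))\<^sup>2) - b i * (dot (z i) (w j) + (1 - r) * dot (z i) (mv (W r) (w j)))\<^sup>2"
            unfolding Wx[OF ij] x_def using r b s ij by (subst tangent_scalar(1)) auto
        qed
      qed
    qed
  next
    fix C assume C: "\<And>x. quad C x \<ge> 0"
    have "frob (tanQ r (W r)) C \<ge> 0" for r
    proof -
      \<comment> \<open>Pairing \<open>Z Z^T\<close> with \<open>C\<close> sums the quadratic form
        of \<open>C\<close> over the columns of \<open>Z\<close>.\<close>
      have "frob (tanQ r (W r)) C = (\<Sum>m\<in>I. quad C (\<lambda>k. tanZ r (W r) k m))"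
        unfolding frob_def tanQ_def quad_alt sum_distrib_right
        by (subst sum_rotate3) (simp add: mult_ac)
      then show ?thesis using C by (simp add: sum_nonneg)
    qed
    then show "frob Q C \<ge> 0"
      using has_integral_nonneg[OF hQ] by blast
  qed
qed

text \<open>The scalar inequality \<open>t - exp k \<le> t * ln t - k * t\<close> is
  \<open>exp x \<ge> 1 + x\<close> at \<open>x = k - ln t\<close>; the doubly stochastic weights
  carry it over to traces. \<open>spec t v\<close> acts as trial matrix in the Gibbs variational
  principle.\<close>

lemma klein_inequality:
  assumes u: "orthonormal_on I u" and v: "orthonormal_on I v" and t: "\<And>j. j \<in> I \<Longrightarrow> t j > 0"
  shows "(\<Sum>j\<in>I. t j) - (\<Sum>i\<in>I. exp (k i)) \<le> (\<Sum>j\<in>I. t j * ln (t j)) - frob (spec k u) (spec t v)"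
proof -
  have 1: "(\<Sum>i\<in>I. (dot (u i) (v j))\<^sup>2) = 1" if "j \<in> I" for j
    using parseval[OF u, of "v j" "v j"] orthonormalD[OF v that that] by (simp add: kron_def power2_eq_square)
  have 2: "(\<Sum>j\<in>I. (dot (u i) (v j))\<^sup>2) = 1" if "i \<in> I" for i
    using parseval[OF v, of "u i" "u i"] orthonormalD[OF u that that]
    by (simp add: kron_def power2_eq_square dot_commute)
  have "(\<Sum>i\<in>I. \<Sum>j\<in>I. (dot (u i) (v j))\<^sup>2 * t j) = (\<Sum>j\<in>I. t j)"
    by (subst sum.swap) (simp add: 1 sum_distrib_right[symmetric])
  moreover have "(\<Sum>i\<in>I. \<Sum>j\<in>I. (dot (u i) (v j))\<^sup>2 * exp (k i)) = (\<Sum>i\<in>I. exp (k i))"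
    by (simp add: 2 sum_distrib_right[symmetric])
  moreover have "(\<Sum>i\<in>I. \<Sum>j\<in>I. (dot (u i) (v j))\<^sup>2 * (t j * ln (t j))) = (\<Sum>j\<in>I. t j * ln (t j))"
    by (subst sum.swap) (simp add: 1 sum_distrib_right[symmetric])
  moreover have "(\<Sum>i\<in>I. \<Sum>j\<in>I. (dot (u i) (v j))\<^sup>2 * t j) - (\<Sum>i\<in>I. \<Sum>j\<in>I. (dot (u i) (v j))\<^sup>2 * exp (k i))
     \<le> (\<Sum>i\<in>I. \<Sum>j\<in>I. (dot (u i) (v j))\<^sup>2 * (t j * ln (t j))) - frob (spec k u) (spec t v)"
    unfolding frob_spec_spec sum_subtractf[symmetric] right_diff_distrib[symmetric]
  proof (intro sum_mono mult_left_mono)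
    fix i j assume "j \<in> I"
    then have tj: "t j > 0" by (rule t)
    have "1 + (k i - ln (t j)) \<le> exp (k i - ln (t j))" by (rule exp_ge_add_one_self)
    then have "t j * (1 + (k i - ln (t j))) \<le> t j * exp (k i - ln (t j))"
      using tj by (intro mult_left_mono) auto
    also have "\<dots> = exp (k i)" using tj by (simp add: exp_diff)
    finally show "t j - exp (k i) \<le> t j * ln (t j) - k i * t j" by (simp add: algebra_simps)
  qed simp
  ultimately show ?thesis by simp
qed

end

subsection \<open>Expectations of random matrices\<close>

text \<open>The Taylor tail is compared with a geometric series through
  \<open>2 * 3 ^ n \<le> fact (n + 2)\<close>, the origin of the 3 in \<open>L / 3\<close>. It is
  applied with \<open>c = \<theta> * L\<close>.\<close>

lemma exp_bernstein_bound:
  fixes c y :: real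
  assumes y: "\<bar>y\<bar> \<le> c" and c: "c < 3"
  shows "exp y \<le> 1 + y + (y\<^sup>2 / 2) / (1 - c / 3)"
proof -
  have fact_ge: "2 * 3 ^ n \<le> (fact (n + 2) :: real)" for n
  proof (induction n)
    case (Suc n)
    have "2 * 3 ^ Suc n \<le> 3 * (fact (n + 2) :: real)" unfolding power_Suc using Suc by linarith
    also have "\<dots> \<le> real (n + 3) * fact (n + 2)" by (intro mult_right_mono) auto
    also have "\<dots> = fact (Suc n + 2)" by (simp add: mult_ac add_ac)
    finally show ?case .
  qed simp
  have sy: "(\<lambda>n. y ^ (n + 2) / fact (n + 2)) sums (exp y - (\<Sum>n<2. y ^ n / fact n))"
    using exp_converges[of y] by (intro sums_split_initial_segment) (simp add: divide_inverse mult.commute)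
  have sc: "(\<lambda>n. y\<^sup>2 / 2 * (c / 3) ^ n) sums (y\<^sup>2 / 2 * (1 / (1 - c / 3)))"
    using y c by (intro sums_mult geometric_sums) auto
  have "y ^ (n + 2) / fact (n + 2) \<le> y\<^sup>2 / 2 * (c / 3) ^ n" for n
  proof -
    have "y ^ (n + 2) / fact (n + 2) \<le> \<bar>y\<bar> ^ (n + 2) / fact (n + 2)"
      unfolding power_abs[symmetric] by (intro divide_right_mono abs_ge_self) auto
    also have "\<dots> \<le> \<bar>y\<bar> ^ (n + 2) / (2 * 3 ^ n)"
      by (intro divide_left_mono fact_ge) auto
    also have "\<dots> = y\<^sup>2 / 2 * (\<bar>y\<bar> ^ n / 3 ^ n)"
      by (simp add: power_add power2_eq_square)
    also have "\<dots> \<le> y\<^sup>2 / 2 * (c ^ n / 3 ^ n)"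
      using y by (intro mult_left_mono divide_right_mono power_mono) auto
    finally show ?thesis by (simp add: power_divide)
  qed
  then have "exp y - (\<Sum>n<2. y ^ n / fact n) \<le> y\<^sup>2 / 2 * (1 / (1 - c / 3))"
    by (rule sums_le[OF _ sy sc])
  then show ?thesis by (simp add: eval_nat_numeral)
qed

context fin_mat
begin

lemma borel_measurable_mexp:
  assumes "\<And>i j. i \<in> I \<Longrightarrow> j \<in> I \<Longrightarrow> (\<lambda>x. A x i j) \<in> borel_measurable N" and ik: "i \<in> I" "k \<in> I"
  shows "(\<lambda>x. mexp (A x) i k) \<in> borel_measurable N"
proof -
  have "(\<lambda>x. mpow (A x) p i k) \<in> borel_measurable N" if "i \<in> I" "k \<in> I" for p i k
    using that
  proof (induction p arbitrary: i k)
    case (Suc p)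
    then show ?case unfolding mpow.simps mmul_def using assms(1) by (intro borel_measurable_sum borel_measurable_times) auto
  qed simp
  then show ?thesis unfolding mexp_def using ik
    by (intro borel_measurable_suminf borel_measurable_divide) auto
qed

lemma borel_measurable_mtr_mexp:
  assumes "\<And>i j. i \<in> I \<Longrightarrow> j \<in> I \<Longrightarrow> (\<lambda>x. A x i j) \<in> borel_measurable N"
  shows "(\<lambda>x. mtr (mexp (A x))) \<in> borel_measurable N"
  unfolding mtr_def using assms by (intro borel_measurable_sum borel_measurable_mexp) auto

text \<open>From \<open>2 |p q| \<le> p^2 + q^2\<close> and completeness, by which the squares of
  \<open>u j i\<close> sum to 1 over \<open>j\<close>. Such bounds turn measurable entries into
  integrable ones.\<close>

lemma spec_entry_bound:
  assumes u: "orthonormal_on I u" and f: "\<And>j. j \<in> I \<Longrightarrow> \<bar>f j\<bar> \<le> c" and ik: "i \<in> I" "k \<in> I" and c: "c \<ge> 0"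
  shows "\<bar>spec f u i k\<bar> \<le> c"
proof -
  have "\<bar>spec f u i k\<bar> \<le> (\<Sum>j\<in>I. \<bar>f j * u j i * u j k\<bar>)"
    unfolding spec_def by (rule sum_abs)
  also have "\<dots> \<le> (\<Sum>j\<in>I. c * (u j i * u j i / 2 + u j k * u j k / 2))"
  proof (intro sum_mono)
    fix j assume j: "j \<in> I"
    have "0 \<le> (\<bar>u j i\<bar> - \<bar>u j k\<bar>)\<^sup>2" by simp
    then have "\<bar>u j i\<bar> * \<bar>u j k\<bar> \<le> u j i * u j i / 2 + u j k * u j k / 2"
      by (simp add: power2_eq_square algebra_simps)
    then have "\<bar>f j\<bar> * (\<bar>u j i\<bar> * \<bar>u j k\<bar>) \<le> c * (u j i * u j i / 2 + u j k * u j k / 2)"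
      using f[OF j] by (intro mult_mono) auto
    then show "\<bar>f j * u j i * u j k\<bar> \<le> c * (u j i * u j i / 2 + u j k * u j k / 2)"
      by (simp add: abs_mult mult.assoc)
  qed
  also have "\<dots> = c * ((\<Sum>j\<in>I. u j i * u j i) / 2 + (\<Sum>j\<in>I. u j k * u j k) / 2)"
    by (simp add: sum_distrib_left sum.distrib sum_divide_distrib distrib_left)
  also have "\<dots> = c"
    using orthonormal_complete[OF u ik(1) ik(1)] orthonormal_complete[OF u ik(2) ik(2)]
    by (simp add: kron_def)
  finally show ?thesis .
qed

lemma entry_bound:
  assumes A: "symm A" "\<And>w. \<bar>quad A w\<bar> \<le> c * dot w w" and c: "c \<ge> 0" and ik: "i \<in> I" "k \<in> I"
  shows "\<bar>A i k\<bar> \<le> c" "\<bar>mexp A i k\<bar> \<le> exp c"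
proof -
  obtain l u where e: "eigdec A l u" by (rule spectral_theorem[OF A(1)])
  have b: "\<bar>l j\<bar> \<le> c" if "j \<in> I" for j by (rule eigenvalue_bounds[OF e that A(2)])
  show "\<bar>A i k\<bar> \<le> c"
    using spec_entry_bound[OF eigdecD(1)[OF e] b ik c] eigdecD(2)[OF e ik] by simp
  have "\<bar>exp (l j)\<bar> \<le> exp c" if "j \<in> I" for j using b[OF that] by simp
  then show "\<bar>mexp A i k\<bar> \<le> exp c"
    using spec_entry_bound[OF eigdecD(1)[OF e] _ ik, of "\<lambda>j. exp (l j)" "exp c"] mexp_spec[OF e ik] by simp
qed

lemma frob_commute: "frob A B = frob B A"
  by (simp add: frob_def mult.commute)

lemma eigdec_scale: "eigdec A l u \<Longrightarrow> eigdec (\<lambda>i j. c * A i j) (\<lambda>j. c * l j) u"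
  by (simp add: eigdec_def spec_def sum_distrib_left mult.assoc)

text \<open>With \<open>x = ln t\<close> and \<open>y = ln a\<close> both sides are
  \<open>tr (T ln T) - tr (T ln A)\<close>.\<close>

lemma sum_entropy_terms:
  assumes u: "orthonormal_on I u" and v: "orthonormal_on I v"
  shows "(\<Sum>i\<in>I. \<Sum>j\<in>I. (dot (u i) (v j))\<^sup>2 * (t j * (x j - y i)))
    = (\<Sum>j\<in>I. t j * x j) - frob (spec y u) (spec t v)"
proof -
  have 1: "(\<Sum>i\<in>I. (dot (u i) (v j))\<^sup>2) = 1" if "j \<in> I" for j
    using parseval[OF u, of "v j" "v j"] orthonormalD[OF v that that] by (simp add: kron_def power2_eq_square)
  have "(\<Sum>j\<in>I. t j * x j) = (\<Sum>i\<in>I. \<Sum>j\<in>I. (dot (u i) (v j))\<^sup>2 * (t j * x j))"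
    by (subst sum.swap) (simp add: 1 sum_distrib_right[symmetric])
  then show ?thesis
    by (simp add: frob_spec_spec sum_subtractf[symmetric] right_diff_distrib mult_ac)
qed

lemma quad_diff: "quad (\<lambda>i j. A i j - B i j) w = quad A w - quad B w"
  by (simp add: quad_alt algebra_simps sum_subtractf)

lemma quad_eigdec: "eigdec A l u \<Longrightarrow> quad A w = (\<Sum>j\<in>I. l j * (dot (u j) w)\<^sup>2)"
  unfolding quad_spec[symmetric] by (intro quad_cong eigdecD(2))

text \<open>Applied to \<open>g V\<close>, it lifts \<open>1 + g V\<close> to
  \<open>exp (g V)\<close>, a matrix with an explicit logarithm.\<close>

lemma quad_mexp_ge:
  assumes "symm A" shows "dot w w + quad A w \<le> quad (mexp A) w"
proof -
  obtain l u where e: "eigdec A l u" by (rule spectral_theorem[OF assms])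
  have "dot w w + quad A w = (\<Sum>j\<in>I. (1 + l j) * (dot (u j) w)\<^sup>2)"
    using parseval[OF eigdecD(1)[OF e], of w w] quad_eigdec[OF e, of w]
    by (simp add: quad_spec distrib_right sum.distrib power2_eq_square)
  also have "\<dots> \<le> (\<Sum>j\<in>I. exp (l j) * (dot (u j) w)\<^sup>2)"
    by (intro sum_mono mult_right_mono) auto
  also have "\<dots> = quad (mexp A) w"
    by (rule quad_eigdec[OF eigdec_exp[OF e], symmetric])
  finally show ?thesis .
qed

text \<open>The scalar Bernstein bound at each eigenvalue \<open>\<theta> * l j\<close>. On
  averaging a centred matrix the linear term disappears and the quadratic one becomes the
  variance.\<close>

lemma quad_mexp_le:
  assumes A: "symm A" "\<And>w. \<bar>quad A w\<bar> \<le> L * dot w w" and th: "\<theta> > 0" "\<theta> * L < 3"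
  shows "quad (mexp (\<lambda>i j. \<theta> * A i j)) w
    \<le> dot w w + \<theta> * quad A w + (\<theta>\<^sup>2 / 2) / (1 - \<theta> * L / 3) * quad (mmul A A) w"
proof -
  obtain l u where e: "eigdec A l u" by (rule spectral_theorem[OF A(1)])
  have b: "\<bar>l j\<bar> \<le> L" if "j \<in> I" for j by (rule eigenvalue_bounds[OF e that A(2)])
  have sq: "quad (mmul A A) w = quad (spec (\<lambda>j. l j * l j) u) w"
    unfolding mmul_spec[OF eigdecD(1)[OF e], symmetric]
    by (intro quad_cong mmul_cong) (auto simp: eigdecD(2)[OF e])
  have "quad (mexp (\<lambda>i j. \<theta> * A i j)) w = (\<Sum>j\<in>I. exp (\<theta> * l j) * (dot (u j) w)\<^sup>2)"
    by (rule quad_eigdec[OF eigdec_exp[OF eigdec_scale[OF e]]])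
  also have "\<dots> \<le> (\<Sum>j\<in>I. (1 + \<theta> * l j + (\<theta>\<^sup>2 / 2) / (1 - \<theta> * L / 3) * (l j * l j)) * (dot (u j) w)\<^sup>2)"
  proof (intro sum_mono mult_right_mono)
    fix j assume j: "j \<in> I"
    have "\<bar>\<theta> * l j\<bar> \<le> \<theta> * L" using b[OF j] th by (simp add: abs_mult)
    note exp_bernstein_bound[OF this th(2)]
    also have "((\<theta> * l j)\<^sup>2 / 2) / (1 - \<theta> * L / 3) = (\<theta>\<^sup>2 / 2) / (1 - \<theta> * L / 3) * (l j * l j)"
      by (simp add: power2_eq_square mult_ac)
    finally show "exp (\<theta> * l j) \<le> 1 + \<theta> * l j + (\<theta>\<^sup>2 / 2) / (1 - \<theta> * L / 3) * (l j * l j)" .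
  qed simp
  also have "\<dots> = dot w w + \<theta> * quad A w + (\<theta>\<^sup>2 / 2) / (1 - \<theta> * L / 3) * quad (mmul A A) w"
    unfolding sq quad_eigdec[OF e, of w] quad_spec
    using parseval[OF eigdecD(1)[OF e], of w w]
    by (simp add: distrib_right sum.distrib power2_eq_square sum_distrib_left mult.assoc)
  finally show ?thesis .
qed

lemma symm_bounded:
  assumes "symm A"
  obtains c where "c \<ge> 0" "\<And>w. \<bar>quad A w\<bar> \<le> c * dot w w"
proof -
  obtain l u where e: "eigdec A l u" by (rule spectral_theorem[OF assms])
  let ?c = "\<Sum>j\<in>I. \<bar>l j\<bar>"
  have le: "\<bar>l j\<bar> \<le> ?c" if "j \<in> I" for j using that fin by (intro member_le_sum) auto
  have "quad A w \<le> ?c * dot w w" for w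
    using le by (intro quad_bounded[OF e]) (auto intro: order_trans[OF abs_ge_self])
  moreover have "quad (\<lambda>i j. (-1) * A i j) w \<le> ?c * dot w w" for w
    using le by (intro quad_bounded[OF eigdec_scale[OF e]]) (auto intro: order_trans[OF abs_ge_minus_self])
  ultimately have "\<bar>quad A w\<bar> \<le> ?c * dot w w" for w
    unfolding quad_scale by (simp add: abs_le_iff)
  then show ?thesis using that[of ?c] by (simp add: sum_nonneg)
qed

lemma symm_mmul_self: "symm A \<Longrightarrow> symm (mmul A A)"
  unfolding symm_def mmul_def by (auto intro!: sum.cong)

lemma mtr_mexp_nonneg: "symm A \<Longrightarrow> mtr (mexp A) \<ge> 0"
  by (metis mtr_mexp spectral_theorem sum_nonneg exp_ge_zero)

lemma symm_add_scale: "symm A \<Longrightarrow> symm B \<Longrightarrow> symm (\<lambda>i j. A i j + c * B i j)"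
  by (auto simp: symm_def)

lemma frob_expectation:
  assumes "\<And>i j. i \<in> I \<Longrightarrow> j \<in> I \<Longrightarrow> integrable M (\<lambda>\<omega>. R \<omega> i j)"
  shows "integrable M (\<lambda>\<omega>. frob C (R \<omega>))"
    and "(\<integral>\<omega>. frob C (R \<omega>) \<partial>M) = frob C (\<lambda>i j. \<integral>\<omega>. R \<omega> i j \<partial>M)"
  unfolding frob_def using assms
  by (auto intro!: Bochner_Integration.integrable_sum simp: Bochner_Integration.integral_sum)

lemma quad_expectation:
  assumes "\<And>i j. i \<in> I \<Longrightarrow> j \<in> I \<Longrightarrow> integrable M (\<lambda>\<omega>. R \<omega> i j)"
  shows "integrable M (\<lambda>\<omega>. quad (R \<omega>) w)"
    and "(\<integral>\<omega>. quad (R \<omega>) w \<partial>M) = quad (\<lambda>i j. \<integral>\<omega>. R \<omega> i j \<partial>M) w"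
  unfolding quad_alt using assms
  by (auto intro!: Bochner_Integration.integrable_sum simp: Bochner_Integration.integral_sum)

text \<open>With \<open>T = exp (H + \<theta> A)\<close>, this comes from averaging the tangent inequality of the relative entropy at
  \<open>(E T, exp (g V))\<close> and applying Klein's inequality to \<open>E T\<close>.\<close>
theorem expectation_mtr_mexp_le:
  fixes A :: "'a \<Rightarrow> 'i \<Rightarrow> 'i \<Rightarrow> real"
  assumes M: "prob_space M"
    and meas: "\<And>i j. i \<in> I \<Longrightarrow> j \<in> I \<Longrightarrow> (\<lambda>\<omega>. A \<omega> i j) \<in> borel_measurable M"
    and sA: "\<And>\<omega>. \<omega> \<in> space M \<Longrightarrow> symm (A \<omega>)"
    and bA: "\<And>\<omega> w. \<omega> \<in> space M \<Longrightarrow> \<bar>quad (A \<omega>) w\<bar> \<le> L * dot w w"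
    and mean: "\<And>i j. i \<in> I \<Longrightarrow> j \<in> I \<Longrightarrow> prob_space.expectation M (\<lambda>\<omega>. A \<omega> i j) = 0"
    and H: "symm H" and L: "L \<ge> 0" and th: "\<theta> > 0" "\<theta> * L < 3"
  defines "V \<equiv> \<lambda>i j. prob_space.expectation M (\<lambda>\<omega>. mmul (A \<omega>) (A \<omega>) i j)"
    and "g \<equiv> (\<theta>\<^sup>2 / 2) / (1 - \<theta> * L / 3)"
    and "K \<equiv> \<lambda>\<omega> i j. H i j + \<theta> * A \<omega> i j"
  shows "integrable M (\<lambda>\<omega>. mtr (mexp (K \<omega>)))"
    and "prob_space.expectation M (\<lambda>\<omega>. mtr (mexp (K \<omega>))) \<le> mtr (mexp (\<lambda>i j. H i j + g * V i j))"
proof -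
  interpret prob_space M by fact
  obtain h where h: "h \<ge> 0" "\<And>w. \<bar>quad H w\<bar> \<le> h * dot w w" using symm_bounded[OF H] by metis
  \<comment> \<open>\<open>c\<close> bounds the spectrum of every \<open>K \<omega>\<close>, so the
    eigenvalues of \<open>T \<omega>\<close> lie between \<open>exp (-c)\<close> and
    \<open>exp c\<close>. The upper end gives integrability, the lower end positivity of the
    mean.\<close>
  define c where "c = h + \<theta> * L"
  have c: "c \<ge> 0" using h L th by (simp add: c_def)
  have sK: "symm (K \<omega>)" if "\<omega> \<in> space M" for \<omega>
    unfolding K_def by (intro symm_add_scale H sA that)
  have bS: "\<bar>quad (\<lambda>i j. \<theta> * A \<omega> i j) w\<bar> \<le> (\<theta> * L) * dot w w" if "\<omega> \<in> space M" for \<omega> w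
    unfolding quad_scale using bA[OF that, of w] th by (simp add: abs_mult mult.assoc)
  have bK: "\<bar>quad (K \<omega>) w\<bar> \<le> c * dot w w" if "\<omega> \<in> space M" for \<omega> w
    unfolding K_def quad_add c_def using bS[OF that, of w] h(2)[of w] by (simp add: distrib_right)
  define T where "T = (\<lambda>\<omega>. mexp (K \<omega>))"
  define E where "E = (\<lambda>\<omega>. mexp (\<lambda>i j. \<theta> * A \<omega> i j))"
  have mT: "(\<lambda>\<omega>. T \<omega> i j) \<in> borel_measurable M" if "i \<in> I" "j \<in> I" for i j
    unfolding T_def K_def using meas that
    by (intro borel_measurable_mexp borel_measurable_add borel_measurable_times) auto
  have mE: "(\<lambda>\<omega>. E \<omega> i j) \<in> borel_measurable M" if "i \<in> I" "j \<in> I" for i j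
    unfolding E_def using meas that
    by (intro borel_measurable_mexp borel_measurable_times) auto
  have bT: "\<bar>T \<omega> i j\<bar> \<le> exp c" if "i \<in> I" "j \<in> I" "\<omega> \<in> space M" for i j \<omega>
    unfolding T_def using entry_bound(2)[OF sK bK c] that by blast
  have bE: "\<bar>E \<omega> i j\<bar> \<le> exp (\<theta> * L)" if "i \<in> I" "j \<in> I" "\<omega> \<in> space M" for i j \<omega>
    unfolding E_def
  proof (rule entry_bound(2)[OF _ bS])
    show "symm (\<lambda>i j. \<theta> * A \<omega> i j)" using sA[OF that(3)] by (simp add: symm_def)
  qed (use that th L in auto)
  have iT: "integrable M (\<lambda>\<omega>. T \<omega> i j)" if "i \<in> I" "j \<in> I" for i j
    using mT bT that by (intro integrable_const_bound[of _ "exp c"]) (auto intro!: AE_I2)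
  have iE: "integrable M (\<lambda>\<omega>. E \<omega> i j)" if "i \<in> I" "j \<in> I" for i j
    using mE bE that by (intro integrable_const_bound[of _ "exp (\<theta> * L)"]) (auto intro!: AE_I2)
  have iA: "integrable M (\<lambda>\<omega>. A \<omega> i j)" if "i \<in> I" "j \<in> I" for i j
    using meas entry_bound(1)[OF sA bA L] that
    by (intro integrable_const_bound[of _ L]) (auto intro!: AE_I2)
  have iAA: "integrable M (\<lambda>\<omega>. mmul (A \<omega>) (A \<omega>) i j)" if "i \<in> I" "j \<in> I" for i j
    unfolding mmul_def
  proof (intro Bochner_Integration.integrable_sum)
    fix k assume k: "k \<in> I"
    show "integrable M (\<lambda>\<omega>. A \<omega> i k * A \<omega> k j)"
      using meas entry_bound(1)[OF sA bA L] that k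
      by (intro integrable_const_bound[of _ "L * L"] AE_I2 borel_measurable_times)
        (auto simp: abs_mult intro!: mult_mono L)
  qed
  show int: "integrable M (\<lambda>\<omega>. mtr (mexp (K \<omega>)))"
    unfolding mtr_def T_def[symmetric] using iT by (intro Bochner_Integration.integrable_sum) (auto simp: T_def)
  define Tb where "Tb = (\<lambda>i j. expectation (\<lambda>\<omega>. T \<omega> i j))"
  define Eb where "Eb = (\<lambda>i j. expectation (\<lambda>\<omega>. E \<omega> i j))"
  have sTb: "symm Tb"
    unfolding symm_def Tb_def T_def using symm_mexp[OF sK]
    by (auto simp: symm_def intro!: Bochner_Integration.integral_cong)
  obtain s w where Tbe: "eigdec Tb s w" by (rule spectral_theorem[OF sTb])
  have sV: "symm V"
    unfolding symm_def V_def using symm_mmul_self[OF sA]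
    by (auto simp: symm_def intro!: Bochner_Integration.integral_cong)
  obtain l z where Ve: "eigdec V l z" by (rule spectral_theorem[OF sV])
  define B where "B = mexp (\<lambda>i j. g * V i j)"
  note gVe = eigdec_scale[OF Ve, of g]
  note Be = eigdec_exp[OF gVe, folded B_def]
  \<comment> \<open>The tangent point involves \<open>ln (s j)\<close>. The bound
    \<open>quad_bounded\<close> is one-sided and is therefore applied to the negative of
    \<open>T \<omega>\<close>.\<close>
  have spos: "s j > 0" if j: "j \<in> I" for j
  proof -
    have "exp (-c) \<le> quad (T \<omega>) (w j)" if \<omega>: "\<omega> \<in> space M" for \<omega>
    proof -
      obtain k v where e: "eigdec (K \<omega>) k v" by (rule spectral_theorem[OF sK[OF \<omega>]])
      have b: "\<bar>k i\<bar> \<le> c" if "i \<in> I" for i by (rule eigenvalue_bounds[OF e that bK[OF \<omega>]])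
      have "quad (\<lambda>i j. (-1) * T \<omega> i j) (w j) \<le> (- exp (-c)) * dot (w j) (w j)"
        unfolding T_def
        by (rule quad_bounded[OF eigdec_scale[OF eigdec_exp[OF e]]]) (use b in \<open>fastforce simp: abs_le_iff\<close>)
      then show ?thesis unfolding quad_scale
        using orthonormalD[OF eigdecD(1)[OF Tbe] j j] by (simp add: kron_def)
    qed
    then have "exp (-c) \<le> expectation (\<lambda>\<omega>. quad (T \<omega>) (w j))"
      using quad_expectation(1)[OF iT] by (intro integral_ge_const AE_I2) auto
    also have "\<dots> = quad Tb (w j)" unfolding Tb_def by (rule quad_expectation(2)[OF iT])
    also have "\<dots> = s j" by (rule quad_eigenvector[OF Tbe j])
    finally show ?thesis by (rule less_le_trans[rotated]) simp
  qed
  obtain P Q where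
    PQ: "\<And>u v a t. \<lbrakk>orthonormal_on I u; orthonormal_on I v; \<And>i. i \<in> I \<Longrightarrow> a i > 0; \<And>i. i \<in> I \<Longrightarrow> t i > 0\<rbrakk> \<Longrightarrow>
       frob P (spec t v) - frob Q (spec a u) \<le> (\<Sum>i\<in>I. \<Sum>j\<in>I. (dot (u i) (v j))\<^sup>2 * (t j * (ln (t j) - ln (a i))))"
    and PQ_eq: "frob P (spec s w) - frob Q (spec (\<lambda>j. exp (g * l j)) z)
        = (\<Sum>i\<in>I. \<Sum>j\<in>I. (dot (z i) (w j))\<^sup>2 * (s j * (ln (s j) - ln (exp (g * l i)))))"
    and Q: "\<And>C. (\<And>x. quad C x \<ge> 0) \<Longrightarrow> frob Q C \<ge> 0"
    by (rule relative_entropy_tangent[OF eigdecD(1)[OF Be] eigdecD(1)[OF Tbe], of "\<lambda>j. exp (g * l j)" s])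
      (use spos in auto)
  \<comment> \<open>The two logarithms are \<open>K \<omega>\<close> and
    \<open>\<theta> A \<omega>\<close>; their difference \<open>H\<close> does not depend on
    \<open>\<omega>\<close>.\<close>
  have pointwise: "frob P (T \<omega>) - frob Q (E \<omega>) \<le> frob H (T \<omega>)" if \<omega>: "\<omega> \<in> space M" for \<omega>
  proof -
    obtain k v where Ke: "eigdec (K \<omega>) k v" by (rule spectral_theorem[OF sK[OF \<omega>]])
    obtain m u where Ae: "eigdec (A \<omega>) m u" by (rule spectral_theorem[OF sA[OF \<omega>]])
    note Ae' = eigdec_scale[OF Ae, of \<theta>]
    note Te = eigdec_exp[OF Ke, folded T_def]
    note Ee = eigdec_exp[OF Ae', folded E_def]
    have "frob P (T \<omega>) - frob Q (E \<omega>) = frob P (spec (\<lambda>j. exp (k j)) v) - frob Q (spec (\<lambda>j. exp (\<theta> * m j)) u)"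
      using eigdecD(2)[OF Te] eigdecD(2)[OF Ee] by (intro arg_cong2[where f = "(-)"] frob_cong) (auto simp: T_def E_def)
    also have "\<dots> \<le> (\<Sum>i\<in>I. \<Sum>j\<in>I. (dot (u i) (v j))\<^sup>2 * (exp (k j) * (k j - \<theta> * m i)))"
      using PQ[OF eigdecD(1)[OF Ae] eigdecD(1)[OF Ke], of "\<lambda>j. exp (\<theta> * m j)" "\<lambda>j. exp (k j)"] by simp
    also have "\<dots> = (\<Sum>j\<in>I. exp (k j) * k j) - frob (spec (\<lambda>j. \<theta> * m j) u) (spec (\<lambda>j. exp (k j)) v)"
      by (rule sum_entropy_terms[OF eigdecD(1)[OF Ae] eigdecD(1)[OF Ke]])
    also have "(\<Sum>j\<in>I. exp (k j) * k j) = frob (K \<omega>) (spec (\<lambda>j. exp (k j)) v)"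
      unfolding frob_spec using quad_eigenvector[OF Ke] by simp
    also have "\<dots> = frob (K \<omega>) (T \<omega>)"
      using eigdecD(2)[OF Te] by (intro frob_cong) (auto simp: T_def)
    also have "frob (spec (\<lambda>j. \<theta> * m j) u) (spec (\<lambda>j. exp (k j)) v) = frob (\<lambda>i j. \<theta> * A \<omega> i j) (T \<omega>)"
      using eigdecD(2)[OF Te] eigdecD(2)[OF Ae'] by (intro frob_cong) (auto simp: T_def)
    also have "frob (K \<omega>) (T \<omega>) - frob (\<lambda>i j. \<theta> * A \<omega> i j) (T \<omega>) = frob H (T \<omega>)"
      unfolding frob_commute[of _ "T \<omega>"] K_def frob_add_right by simp
    finally show ?thesis .
  qed
  have "expectation (\<lambda>\<omega>. frob P (T \<omega>) - frob Q (E \<omega>)) \<le> expectation (\<lambda>\<omega>. frob H (T \<omega>))"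
    using frob_expectation(1)[OF iT] frob_expectation(1)[OF iE] pointwise by (intro integral_mono) auto
  then have 1: "frob P Tb - frob Q Eb \<le> frob H Tb"
    using frob_expectation[OF iT] frob_expectation[OF iE] by (simp add: Tb_def Eb_def)
  \<comment> \<open>As quadratic forms, \<open>Eb \<le> 1 + g V \<le> B\<close>. Monotonicity in
    \<open>Q\<close> then replaces \<open>Eb\<close> by \<open>B\<close>, where the tangent is
    exact.\<close>
  have "quad (\<lambda>i j. B i j - Eb i j) x \<ge> 0" for x
  proof -
    have "quad Eb x = expectation (\<lambda>\<omega>. quad (E \<omega>) x)"
      unfolding Eb_def by (rule quad_expectation(2)[OF iE, symmetric])
    also have "\<dots> \<le> expectation (\<lambda>\<omega>. dot x x + \<theta> * quad (A \<omega>) x + g * quad (mmul (A \<omega>) (A \<omega>)) x)"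
      using quad_expectation(1)[OF iE] quad_expectation(1)[OF iA] quad_expectation(1)[OF iAA] quad_mexp_le[OF sA bA th, folded g_def E_def]
      by (intro integral_mono) (auto simp: E_def)
    also have "\<dots> = dot x x + \<theta> * expectation (\<lambda>\<omega>. quad (A \<omega>) x) + g * expectation (\<lambda>\<omega>. quad (mmul (A \<omega>) (A \<omega>)) x)"
      using quad_expectation(1)[OF iA] quad_expectation(1)[OF iAA] by (simp add: prob_space)
    also have "expectation (\<lambda>\<omega>. quad (mmul (A \<omega>) (A \<omega>)) x) = quad V x"
      unfolding V_def by (rule quad_expectation(2)[OF iAA])
    also have "expectation (\<lambda>\<omega>. quad (A \<omega>) x) = 0"
      by (subst quad_expectation(2)[OF iA]) (simp_all add: quad_alt mean)
    also have "dot x x + \<theta> * 0 + g * quad V x \<le> quad B x"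
      using quad_mexp_ge[of "\<lambda>i j. g * V i j" x] sV unfolding B_def quad_scale by (simp add: symm_def)
    finally show ?thesis by (simp add: quad_diff)
  qed
  from Q[OF this] have 2: "frob Q Eb \<le> frob Q B" by (simp add: frob_diff_right)
  have "frob P Tb - frob Q B = frob P (spec s w) - frob Q (spec (\<lambda>j. exp (g * l j)) z)"
    using eigdecD(2)[OF Tbe] eigdecD(2)[OF Be] by (intro arg_cong2[where f = "(-)"] frob_cong) auto
  also have "\<dots> = (\<Sum>j\<in>I. s j * ln (s j)) - frob (spec (\<lambda>j. g * l j) z) (spec s w)"
    unfolding PQ_eq using sum_entropy_terms[OF eigdecD(1)[OF Ve] eigdecD(1)[OF Tbe]] by simp
  also have "frob (spec (\<lambda>j. g * l j) z) (spec s w) = frob (\<lambda>i j. g * V i j) Tb"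
    using eigdecD(2)[OF Tbe] eigdecD(2)[OF gVe] by (intro frob_cong) auto
  \<comment> \<open>Exactness turns \<open>frob P Tb - frob Q B\<close> into
    \<open>tr (Tb ln Tb) - tr (g V Tb)\<close>, which is at most \<open>tr (H Tb)\<close> by
    \<open>1\<close> and \<open>2\<close>.\<close>
  finally have 3: "(\<Sum>j\<in>I. s j * ln (s j)) \<le> frob (\<lambda>i j. H i j + g * V i j) Tb"
    using 1 2 unfolding frob_commute[of _ Tb] frob_add_right by simp
  have "symm (\<lambda>i j. H i j + g * V i j)" by (intro symm_add_scale H sV)
  then obtain k y where Ge: "eigdec (\<lambda>i j. H i j + g * V i j) k y" by (rule spectral_theorem)
  have "frob (spec k y) (spec s w) = frob (\<lambda>i j. H i j + g * V i j) Tb"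
    using eigdecD(2)[OF Tbe] eigdecD(2)[OF Ge] by (intro frob_cong) auto
  \<comment> \<open>By \<open>3\<close> the right side of Klein's inequality is at most 0.\<close>
  then have "(\<Sum>j\<in>I. s j) \<le> (\<Sum>i\<in>I. exp (k i))"
    using klein_inequality[OF eigdecD(1)[OF Ge] eigdecD(1)[OF Tbe], of s k] spos 3 by simp
  moreover have "expectation (\<lambda>\<omega>. mtr (mexp (K \<omega>))) = mtr Tb"
    unfolding mtr_def Tb_def T_def[symmetric] using iT by (simp add: T_def Bochner_Integration.integral_sum)
  moreover have "mtr Tb = (\<Sum>j\<in>I. s j)"
    using mtr_spec[OF eigdecD(1)[OF Tbe], of s] eigdecD(2)[OF Tbe] by (simp add: mtr_def)
  ultimately show "expectation (\<lambda>\<omega>. mtr (mexp (K \<omega>))) \<le> mtr (mexp (\<lambda>i j. H i j + g * V i j))"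
    using mtr_mexp[OF Ge] by simp
qed

text \<open>The summands are integrated out one at a time, the last one first; the variance terms
  already produced are absorbed into \<open>H\<close>.\<close>
theorem nn_integral_mtr_mexp_sum_le:
  fixes X :: "nat \<Rightarrow> 'a \<Rightarrow> 'b" and F :: "'b \<Rightarrow> 'i \<Rightarrow> 'i \<Rightarrow> real"
  assumes M: "prob_space M"
    and ind: "prob_space.indep_vars M (\<lambda>_. N) X {..<n}"
    and mF: "\<And>i j. i \<in> I \<Longrightarrow> j \<in> I \<Longrightarrow> (\<lambda>x. F x i j) \<in> borel_measurable N"
    and sF: "\<And>k \<omega>. k < n \<Longrightarrow> \<omega> \<in> space M \<Longrightarrow> symm (F (X k \<omega>))"
    and bF: "\<And>k \<omega> w. k < n \<Longrightarrow> \<omega> \<in> space M \<Longrightarrow> \<bar>quad (F (X k \<omega>)) w\<bar> \<le> L * dot w w"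
    and mean: "\<And>k i j. k < n \<Longrightarrow> i \<in> I \<Longrightarrow> j \<in> I \<Longrightarrow> prob_space.expectation M (\<lambda>\<omega>. F (X k \<omega>) i j) = 0"
    and L: "L \<ge> 0" and th: "\<theta> > 0" "\<theta> * L < 3"
    and H: "symm H"
  defines "V \<equiv> \<lambda>k i j. prob_space.expectation M (\<lambda>\<omega>. mmul (F (X k \<omega>)) (F (X k \<omega>)) i j)"
    and "g \<equiv> (\<theta>\<^sup>2 / 2) / (1 - \<theta> * L / 3)"
  shows "(\<integral>\<^sup>+\<omega>. ennreal (mtr (mexp (\<lambda>i j. H i j + \<theta> * (\<Sum>k<n. F (X k \<omega>) i j)))) \<partial>M)
    \<le> ennreal (mtr (mexp (\<lambda>i j. H i j + g * (\<Sum>k<n. V k i j))))"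
  using ind sF bF mean H
proof (induction n arbitrary: H)
  case 0
  interpret prob_space M by fact
  show ?case by (simp add: emeasure_space_1)
next
  case (Suc n)
  interpret prob_space M by fact
  note ind = Suc.prems(1) and sF = Suc.prems(2) and bF = Suc.prems(3) and mean = Suc.prems(4) and H = Suc.prems(5)
  have rv: "X k \<in> measurable M N" if "k < Suc n" for k
    using ind that by (auto simp: indep_vars_def)
  have mFX: "(\<lambda>\<omega>. F (X k \<omega>) i j) \<in> borel_measurable M" if "k < Suc n" "i \<in> I" "j \<in> I" for k i j
    by (rule measurable_compose[OF rv[OF that(1)] mF[OF that(2,3)]])
  have sV: "symm (V n)"
    unfolding symm_def V_def using symm_mmul_self[OF sF]
    by (auto simp: symm_def intro!: Bochner_Integration.integral_cong)
  \<comment> \<open>The indices split into the block \<open>{..<n}\<close> and the single index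
    \<open>n\<close>; independence makes the joint law of the two restricted families a product
    measure.\<close>
  let ?R = "\<lambda>\<omega>. restrict (\<lambda>k. X k \<omega>) {..<n}" and ?S = "\<lambda>\<omega>. restrict (\<lambda>k. X k \<omega>) {n}"
  let ?P = "PiM {..<n} (\<lambda>_. N)" and ?Q = "PiM {n} (\<lambda>_. N)"
  define f where "f = (\<lambda>(x, y). ennreal (mtr (mexp (\<lambda>i j. H i j + \<theta> * (\<Sum>k<n. F (x k) i j) + \<theta> * F (y n) i j))))"
  have iv: "indep_var ?P ?R ?Q ?S"
    by (rule indep_var_restrict[OF ind]) auto
  have mR: "?R \<in> measurable M ?P" and mS: "?S \<in> measurable M ?Q"
    using iv by (auto simp: indep_var_distribution_eq)
  have mf: "f \<in> borel_measurable (?P \<Otimes>\<^sub>M ?Q)"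
  proof -
    have 1: "(\<lambda>z. F (fst z k) i j) \<in> borel_measurable (?P \<Otimes>\<^sub>M ?Q)" if "k < n" "i \<in> I" "j \<in> I" for k i j
      using that by (intro measurable_compose[OF _ mF] measurable_compose[OF measurable_fst measurable_component_singleton]) auto
    have 2: "(\<lambda>z. F (snd z n) i j) \<in> borel_measurable (?P \<Otimes>\<^sub>M ?Q)" if "i \<in> I" "j \<in> I" for i j
      using that by (intro measurable_compose[OF _ mF] measurable_compose[OF measurable_snd measurable_component_singleton]) auto
    have "(\<lambda>z. mtr (mexp (\<lambda>i j. H i j + \<theta> * (\<Sum>k<n. F (fst z k) i j) + \<theta> * F (snd z n) i j)))
        \<in> borel_measurable (?P \<Otimes>\<^sub>M ?Q)"
      using 1 2 by (intro borel_measurable_mtr_mexp borel_measurable_add borel_measurable_times borel_measurable_sum) auto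
    then show ?thesis by (simp add: f_def case_prod_beta)
  qed
  interpret SQ: prob_space "distr M ?Q ?S" by (rule prob_space_distr[OF mS])
  have mf2: "(\<lambda>y. f (x, y)) \<in> borel_measurable ?Q" if "x \<in> space ?P" for x
    using measurable_compose[OF measurable_Pair1'[OF that] mf] by simp
  have "(\<integral>\<^sup>+\<omega>. ennreal (mtr (mexp (\<lambda>i j. H i j + \<theta> * (\<Sum>k<Suc n. F (X k \<omega>) i j)))) \<partial>M) = (\<integral>\<^sup>+\<omega>. f (?R \<omega>, ?S \<omega>) \<partial>M)"
    by (simp add: f_def distrib_left add.assoc)
  also have "\<dots> = (\<integral>\<^sup>+z. f z \<partial>(distr M (?P \<Otimes>\<^sub>M ?Q) (\<lambda>\<omega>. (?R \<omega>, ?S \<omega>))))"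
    using mR mS mf by (subst nn_integral_distr) auto
  also have "distr M (?P \<Otimes>\<^sub>M ?Q) (\<lambda>\<omega>. (?R \<omega>, ?S \<omega>)) = distr M ?P ?R \<Otimes>\<^sub>M distr M ?Q ?S"
    using iv by (simp add: indep_var_distribution_eq)
  \<comment> \<open>Fubini for nonnegative functions asks for measurability alone, the reason for
    working with \<open>nn_integral\<close>.\<close>
  also have "(\<integral>\<^sup>+z. f z \<partial>(distr M ?P ?R \<Otimes>\<^sub>M distr M ?Q ?S))
      = (\<integral>\<^sup>+x. (\<integral>\<^sup>+y. f (x, y) \<partial>distr M ?Q ?S) \<partial>distr M ?P ?R)"
    using mf by (intro SQ.nn_integral_fst[symmetric]) simp
  also have "\<dots> = (\<integral>\<^sup>+\<omega>. (\<integral>\<^sup>+y. f (?R \<omega>, y) \<partial>distr M ?Q ?S) \<partial>M)"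
    using mR mf by (subst nn_integral_distr) (auto intro!: SQ.borel_measurable_nn_integral_fst)
  also have "\<dots> \<le> (\<integral>\<^sup>+\<omega>. ennreal (mtr (mexp (\<lambda>i j. (H i j + g * V n i j) + \<theta> * (\<Sum>k<n. F (X k \<omega>) i j)))) \<partial>M)"
  proof (rule nn_integral_mono)
    fix \<omega> assume \<omega>: "\<omega> \<in> space M"
    \<comment> \<open>For a fixed outcome of the earlier summands this matrix is constant, so the
      bound for a single random matrix applies.\<close>
    let ?H = "\<lambda>i j. H i j + \<theta> * (\<Sum>k<n. F (X k \<omega>) i j)"
    have sH: "symm ?H"
      using H sF[OF _ \<omega>] by (auto simp: symm_def intro!: sum.cong)
    have sH': "symm (\<lambda>i j. ?H i j + \<theta> * F (X n \<omega>') i j)" if "\<omega>' \<in> space M" for \<omega>'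
      using sF[OF _ that] by (intro symm_add_scale sH) auto
    note step = expectation_mtr_mexp_le[OF M, where A = "\<lambda>\<omega>. F (X n \<omega>)" and L = L and H = ?H and \<theta> = \<theta>,
        OF mFX[OF lessI] sF[OF lessI] bF[OF lessI] mean[OF lessI] sH L th]
    have "(\<integral>\<^sup>+y. f (?R \<omega>, y) \<partial>distr M ?Q ?S) = (\<integral>\<^sup>+\<omega>'. f (?R \<omega>, ?S \<omega>') \<partial>M)"
      using mS mf2[OF measurable_space[OF mR \<omega>]] by (subst nn_integral_distr) auto
    also have "\<dots> = (\<integral>\<^sup>+\<omega>'. ennreal (mtr (mexp (\<lambda>i j. ?H i j + \<theta> * F (X n \<omega>') i j))) \<partial>M)"
      by (simp add: f_def)
    also have "\<dots> = ennreal (expectation (\<lambda>\<omega>'. mtr (mexp (\<lambda>i j. ?H i j + \<theta> * F (X n \<omega>') i j))))"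
      using step(1) mtr_mexp_nonneg[OF sH'] by (intro nn_integral_eq_integral AE_I2) auto
    also have "\<dots> \<le> ennreal (mtr (mexp (\<lambda>i j. ?H i j + g * V n i j)))"
      using step(2) by (intro ennreal_leI) (simp add: V_def g_def)
    finally show "(\<integral>\<^sup>+y. f (?R \<omega>, y) \<partial>distr M ?Q ?S)
        \<le> ennreal (mtr (mexp (\<lambda>i j. (H i j + g * V n i j) + \<theta> * (\<Sum>k<n. F (X k \<omega>) i j))))"
      by (simp add: add_ac)
  qed
  also have "\<dots> \<le> ennreal (mtr (mexp (\<lambda>i j. (H i j + g * V n i j) + g * (\<Sum>k<n. V k i j))))"
  proof (rule Suc.IH)
    show "indep_vars (\<lambda>_. N) X {..<n}"
      by (rule indep_vars_subset[OF ind]) auto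
    show "symm (\<lambda>i j. H i j + g * V n i j)" by (intro symm_add_scale H sV)
  qed (use sF bF mean in auto)
  finally show ?case by (simp add: distrib_left add_ac)
qed

section \<open>Trace exponential and extreme eigenvalues\<close>

lemma mtr_mexp_le:
  assumes A: "symm A" and q: "\<And>w. quad A w \<le> c * dot w w"
  shows "mtr (mexp A) \<le> card I * exp c"
proof -
  obtain l u where e: "eigdec A l u" by (rule spectral_theorem[OF A])
  have "l j \<le> c" if j: "j \<in> I" for j
    using q[of "u j"] quad_eigenvector[OF e j] orthonormalD[OF eigdecD(1)[OF e] j j] by (simp add: kron_def)
  then have "(\<Sum>j\<in>I. exp (l j)) \<le> (\<Sum>j\<in>I. exp c)" by (intro sum_mono) auto
  then show ?thesis by (simp add: mtr_mexp[OF e])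
qed

text \<open>If all eigenvalues were below \<open>s\<close>, so would be the Rayleigh quotient of
  \<open>w\<close>, which has a nonzero coefficient in the eigenbasis. One eigenvalue of
  \<open>mexp A\<close> is then at most the sum of all of them.\<close>

lemma exp_rayleigh_le_mtr_mexp:
  assumes A: "symm A" and w: "dot w w > 0" "s * dot w w \<le> quad A w"
  shows "exp s \<le> mtr (mexp A)"
proof -
  obtain l u where e: "eigdec A l u" by (rule spectral_theorem[OF A])
  have "\<exists>j\<in>I. s \<le> l j"
  proof (rule ccontr)
    assume "\<not> (\<exists>j\<in>I. s \<le> l j)"
    then have lt: "\<And>j. j \<in> I \<Longrightarrow> l j < s" by auto
    have W: "dot w w = (\<Sum>j\<in>I. (dot (u j) w)\<^sup>2)"
      using parseval[OF eigdecD(1)[OF e], of w w] by (simp add: power2_eq_square)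
    then obtain j where j: "j \<in> I" "(dot (u j) w)\<^sup>2 > 0"
      using w(1) by (metis not_le sum_nonpos)
    have "quad A w < (\<Sum>j\<in>I. s * (dot (u j) w)\<^sup>2)"
      unfolding quad_eigdec[OF e, of w]
    proof (rule sum_strict_mono_ex1[OF fin])
      show "\<forall>j\<in>I. l j * (dot (u j) w)\<^sup>2 \<le> s * (dot (u j) w)\<^sup>2"
        by (intro ballI mult_right_mono) (auto simp: lt less_imp_le)
      show "\<exists>j\<in>I. l j * (dot (u j) w)\<^sup>2 < s * (dot (u j) w)\<^sup>2"
        using mult_strict_right_mono[OF lt[OF j(1)] j(2)] j(1) by blast
    qed
    then show False using w(2) W by (simp add: sum_distrib_left)
  qed
  then obtain j where j: "j \<in> I" "s \<le> l j" by blast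
  have "exp s \<le> exp (l j)" using j by simp
  also have "\<dots> \<le> (\<Sum>j\<in>I. exp (l j))" using j fin by (intro member_le_sum) auto
  finally show ?thesis by (simp add: mtr_mexp[OF e])
qed

end

subsection \<open>From the moment generating function to tail and mean\<close>

text \<open>The Laplace transform method with the matrices removed: \<open>Z \<theta>\<close> stands
  for the trace exponential, \<open>D\<close> for the dimension of the dilation.\<close>

lemma bernstein_from_mgf:
  fixes S :: "'a \<Rightarrow> real" and Z :: "real \<Rightarrow> 'a \<Rightarrow> real" and D L \<nu> :: real
  assumes M: "prob_space M" and D: "D \<ge> 2" and L: "L \<ge> 0" and nu: "\<nu> \<ge> 0"
    and mZ: "\<And>\<theta>. Z \<theta> \<in> borel_measurable M"
    and SZ: "\<And>\<theta> \<omega>. \<theta> > 0 \<Longrightarrow> \<omega> \<in> space M \<Longrightarrow> exp (\<theta> * S \<omega>) \<le> Z \<theta> \<omega>"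
    and Z: "\<And>\<theta>. \<theta> > 0 \<Longrightarrow> \<theta> * L < 3 \<Longrightarrow>
      (\<integral>\<^sup>+\<omega>. ennreal (Z \<theta> \<omega>) \<partial>M) \<le> ennreal (D * exp ((\<theta>\<^sup>2 / 2) / (1 - \<theta> * L / 3) * \<nu>))"
  shows "prob_space.expectation M S \<le> sqrt (2 * \<nu> * ln D) + L * ln D / 3"
    and "t \<ge> 0 \<Longrightarrow> prob_space.prob M {\<omega> \<in> space M. S \<omega> \<ge> t} \<le> D * exp ((- (t ^ 2) / 2) / (\<nu> + L * t / 3))"
proof -
  interpret prob_space M by fact
  have lnD: "ln D > 0" using D by simp
  have lt3: "q * L < 3" if "1 - q * L / 3 > 0" for q using that by linarith
  have Z0: "Z \<theta> \<omega> \<ge> 0" if "\<theta> > 0" "\<omega> \<in> space M" for \<theta> \<omega>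
    using SZ[OF that] exp_gt_zero[of "\<theta> * S \<omega>"] by linarith
  have iZ: "integrable M (Z \<theta>)" and EZ: "expectation (Z \<theta>) \<le> D * exp ((\<theta>\<^sup>2 / 2) / (1 - \<theta> * L / 3) * \<nu>)"
    if \<theta>: "\<theta> > 0" "\<theta> * L < 3" for \<theta>
  proof -
    show i: "integrable M (Z \<theta>)"
      using Z[OF \<theta>] Z0[OF \<theta>(1)] by (intro integrableI_nonneg mZ AE_I2) (auto intro: le_less_trans)
    have "ennreal (expectation (Z \<theta>)) \<le> ennreal (D * exp ((\<theta>\<^sup>2 / 2) / (1 - \<theta> * L / 3) * \<nu>))"
      using Z[OF \<theta>] nn_integral_eq_integral[OF i AE_I2] Z0[OF \<theta>(1)] by simp
    then show "expectation (Z \<theta>) \<le> D * exp ((\<theta>\<^sup>2 / 2) / (1 - \<theta> * L / 3) * \<nu>)"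
      using D by (subst (asm) ennreal_le_iff) auto
  qed
  have tail: "prob {\<omega> \<in> space M. S \<omega> \<ge> t} \<le> D * exp ((\<theta>\<^sup>2 / 2) / (1 - \<theta> * L / 3) * \<nu> - \<theta> * t)"
    if \<theta>: "\<theta> > 0" "\<theta> * L < 3" for \<theta> t
  proof (cases "{\<omega> \<in> space M. S \<omega> \<ge> t} \<in> sets M")
    case True
    have "prob {\<omega> \<in> space M. S \<omega> \<ge> t} = expectation (indicator {\<omega> \<in> space M. S \<omega> \<ge> t})"
      using True by simp
    also have "\<dots> \<le> expectation (\<lambda>\<omega>. exp (- (\<theta> * t)) * Z \<theta> \<omega>)"
    proof (rule integral_mono)
      fix \<omega> assume \<omega>: "\<omega> \<in> space M"
      show "indicator {\<omega> \<in> space M. S \<omega> \<ge> t} \<omega> \<le> exp (- (\<theta> * t)) * Z \<theta> \<omega>"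
      proof (cases "S \<omega> \<ge> t")
        case True
        have "1 \<le> exp (- (\<theta> * t)) * exp (\<theta> * S \<omega>)"
          unfolding exp_add[symmetric] using True \<theta> by simp
        also have "\<dots> \<le> exp (- (\<theta> * t)) * Z \<theta> \<omega>"
          using SZ[OF \<theta>(1) \<omega>] by simp
        finally show ?thesis using True \<omega> by simp
      qed (use Z0[OF \<theta>(1) \<omega>] in simp)
    qed (use True iZ[OF \<theta>] in \<open>auto simp: emeasure_eq_measure\<close>)
    also have "\<dots> \<le> exp (- (\<theta> * t)) * (D * exp ((\<theta>\<^sup>2 / 2) / (1 - \<theta> * L / 3) * \<nu>))"
      using EZ[OF \<theta>] by simp
    finally show ?thesis by (simp add: exp_diff exp_minus field_simps)
  next
    \<comment> \<open>A set outside \<open>sets M\<close> has measure 0 by convention.\<close>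
    case False
    then show ?thesis using D by (simp add: measure_notin_sets)
  qed
  show "prob {\<omega> \<in> space M. S \<omega> \<ge> t} \<le> D * exp ((- (t ^ 2) / 2) / (\<nu> + L * t / 3))" if t: "t \<ge> 0"
  \<comment> \<open>Division by zero gives 0, so a vanishing denominator leaves the bound
    \<open>D\<close>, just as \<open>t = 0\<close> does.\<close>
  proof (cases "\<nu> + L * t / 3 = 0 \<or> t = 0")
    case True
    then have "(- (t ^ 2) / 2) / (\<nu> + L * t / 3) = 0" by auto
    moreover have "prob {\<omega> \<in> space M. S \<omega> \<ge> t} \<le> D * exp 0"
      using D prob_le_1 by (auto intro: order_trans)
    ultimately show ?thesis by (simp only:)
  next
    case False
    then have tp: "t > 0" and den: "\<nu> + L * t / 3 > 0"
      using t L nu by (auto simp: less_le add_nonneg_nonneg)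
    show ?thesis
    proof (cases "\<nu> = 0")
      case True
      \<comment> \<open>The usual \<open>\<theta> = t / (\<nu> + L * t / 3)\<close> would be
        \<open>3 / L\<close>, the excluded endpoint. With zero variance, half of it already gives
        the claimed exponent.\<close>
      then have Lp: "L > 0" using den L by (auto simp: less_le)
      have "prob {\<omega> \<in> space M. S \<omega> \<ge> t} \<le> D * exp (- (3 / (2 * L) * t))"
        using tail[of "3 / (2 * L)" t] Lp True by simp
      also have "- (3 / (2 * L) * t) = (- (t ^ 2) / 2) / (\<nu> + L * t / 3)"
        using True Lp tp by (simp add: power2_eq_square field_simps)
      finally show ?thesis .
    next
      case False
      then have nup: "\<nu> > 0" using nu by simp
      \<comment> \<open>With \<open>\<theta> = t / x\<close> the exponent is
        \<open>t^2 / (2 x) - t^2 / x\<close>.\<close>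
      define x where "x = \<nu> + L * t / 3"
      have x: "x > 0" using den by (simp add: x_def)
      have Lx: "1 - t / x * L / 3 = \<nu> / x" using x by (simp add: x_def field_simps)
      have "\<nu> / x > 0" "t / x > 0" using nup x tp by simp_all
      moreover from this have "t / x * L < 3" by (intro lt3) (simp only: Lx)
      ultimately have "t / x > 0" "t / x * L < 3" by simp_all
      from tail[OF this, of t]
      have "prob {\<omega> \<in> space M. S \<omega> \<ge> t} \<le> D * exp (((t / x)\<^sup>2 / 2) / (\<nu> / x) * \<nu> - t / x * t)"
        unfolding Lx .
      also have "((t / x)\<^sup>2 / 2) / (\<nu> / x) * \<nu> - t / x * t = (- (t ^ 2) / 2) / x"
        using x nup by (simp add: power2_eq_square field_simps)
      finally show ?thesis by (simp add: x_def)
    qed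
  qed
  show "expectation S \<le> sqrt (2 * \<nu> * ln D) + L * ln D / 3"
  proof (cases "integrable M S")
    \<comment> \<open>A function that is not integrable has expectation 0 by convention.\<close>
    case False
    then show ?thesis using L lnD nu by (simp add: not_integrable_integral_eq)
  next
    case iS: True
    \<comment> \<open>Jensen's inequality for the logarithm, through its tangent at
      \<open>c\<close>, the upper bound for the mean of \<open>Z \<theta>\<close>:
      \<open>ln z \<le> ln c - 1 + z / c\<close>.\<close>
    have bound: "expectation S \<le> (ln D + (\<theta>\<^sup>2 / 2) / (1 - \<theta> * L / 3) * \<nu>) / \<theta>" if \<theta>: "\<theta> > 0" "\<theta> * L < 3" for \<theta>
    proof -
      define c where "c = D * exp ((\<theta>\<^sup>2 / 2) / (1 - \<theta> * L / 3) * \<nu>)"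
      have c: "c > 0" using D by (simp add: c_def)
      have "expectation (\<lambda>\<omega>. \<theta> * S \<omega>) \<le> expectation (\<lambda>\<omega>. ln c - 1 + Z \<theta> \<omega> / c)"
      proof (rule integral_mono)
        fix \<omega> assume \<omega>: "\<omega> \<in> space M"
        have "\<theta> * S \<omega> - ln c \<le> exp (\<theta> * S \<omega> - ln c) - 1"
          using exp_ge_add_one_self[of "\<theta> * S \<omega> - ln c"] by linarith
        also have "exp (\<theta> * S \<omega> - ln c) = exp (\<theta> * S \<omega>) / c" using c by (simp add: exp_diff)
        also have "\<dots> \<le> Z \<theta> \<omega> / c" using SZ[OF \<theta>(1) \<omega>] c by (simp add: divide_right_mono)
        finally show "\<theta> * S \<omega> \<le> ln c - 1 + Z \<theta> \<omega> / c" by simp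
      qed (use iS iZ[OF \<theta>] in auto)
      also have "\<dots> = ln c - 1 + expectation (Z \<theta>) / c"
        using iZ[OF \<theta>] by (simp add: prob_space)
      also have "\<dots> \<le> ln c" using EZ[OF \<theta>] c by (simp add: c_def)
      also have "\<dots> = ln D + (\<theta>\<^sup>2 / 2) / (1 - \<theta> * L / 3) * \<nu>" using D by (simp add: c_def ln_mult)
      finally show ?thesis using \<theta> by (simp add: field_simps)
    qed
    \<comment> \<open>The substitution \<open>\<theta> = 1 / (L / 3 + x)\<close> splits off the term
      in \<open>L\<close> and leaves a free minimisation over \<open>x > 0\<close>.\<close>
    have bx: "expectation S \<le> L * ln D / 3 + x * ln D + \<nu> / (2 * x)" if x: "x > 0" for x
    proof -
      define y where "y = L / 3 + x"
      have y: "y > 0" using L x by (simp add: y_def add_nonneg_pos)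
      have Ly: "1 - 1 / y * L / 3 = x / y" using y by (simp add: y_def field_simps)
      have "x / y > 0" "1 / y > 0" using x y by simp_all
      moreover from this have "1 / y * L < 3" by (intro lt3) (simp only: Ly)
      ultimately have "1 / y > 0" "1 / y * L < 3" by simp_all
      from bound[OF this] have "expectation S \<le> (ln D + ((1 / y)\<^sup>2 / 2) / (x / y) * \<nu>) / (1 / y)"
        unfolding Ly .
      also have "\<dots> = y * ln D + \<nu> / (2 * x)"
        using x y by (simp add: power2_eq_square field_simps)
      finally show ?thesis by (simp add: y_def field_simps)
    qed
    show ?thesis
    proof (cases "\<nu> = 0")
      case True
      \<comment> \<open>With \<open>\<nu> = 0\<close> the infimum is approached as \<open>x\<close>
        tends to 0, hence the arbitrary \<open>e\<close>.\<close>
      have "expectation S \<le> L * ln D / 3 + e" if e: "e > 0" for e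
        using bx[of "e / ln D"] lnD True e by simp
      then have "expectation S \<le> L * ln D / 3" by (rule field_le_epsilon)
      then show ?thesis using True by simp
    next
      case False
      \<comment> \<open>The minimiser is \<open>x = r / (2 * ln D)\<close>; both remaining terms
        then equal \<open>r / 2\<close>.\<close>
      define r where "r = sqrt (2 * \<nu> * ln D)"
      have r: "r > 0" "r * r = 2 * \<nu> * ln D" using False nu lnD by (auto simp: r_def)
      have "expectation S \<le> L * ln D / 3 + r / (2 * ln D) * ln D + \<nu> / (2 * (r / (2 * ln D)))"
        using r lnD by (intro bx) simp
      also have "r / (2 * ln D) * ln D = r / 2" using lnD by simp
      also have "\<nu> / (2 * (r / (2 * ln D))) = r / 2"
        using r lnD by (simp add: field_simps)
      finally show ?thesis by (simp add: r_def)
    qed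
  qed
qed

subsection \<open>Index bijection and the Einstein spectral norm\<close>

lemma length_unflat [simp]: "length (unflat p d i) = p"
  by (simp add: unflat_def)

lemma unflat_in_tidx: "d \<ge> 1 \<Longrightarrow> unflat p d i \<in> tidx p d"
  by (auto simp: unflat_def tidx_def)

lemma unflat_append_in_tidx: "d \<ge> 1 \<Longrightarrow> unflat p d i @ unflat q d j \<in> tidx (p + q) d"
  using unflat_in_tidx[of d p i] unflat_in_tidx[of d q j] by (auto simp: tidx_def)

lemma mod_eq_of_digits_eq:
  fixes d :: nat
  assumes "\<And>l. l < p \<Longrightarrow> i div d ^ l mod d = j div d ^ l mod d"
  shows "i mod d ^ p = j mod d ^ p"
  using assms
proof (induction p)
  case (Suc p)
  have "x mod d ^ Suc p = d ^ p * (x div d ^ p mod d) + x mod d ^ p" for x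
    unfolding power_Suc2 by (rule mod_mult2_eq)
  then show ?case using Suc by simp
qed simp

text \<open>Injective since base-\<open>d\<close> digits determine a number below
  \<open>d ^ p\<close>; surjective since both sides have \<open>d ^ p\<close> elements.\<close>

lemma bij_betw_unflat:
  assumes d: "d \<ge> 1"
  shows "bij_betw (unflat p d) {..<d ^ p} (tidx p d)"
proof -
  have inj: "inj_on (unflat p d) {..<d ^ p}"
  proof (rule inj_onI)
    fix i j assume ij: "i \<in> {..<d ^ p}" "j \<in> {..<d ^ p}" and eq: "unflat p d i = unflat p d j"
    have "i div d ^ l mod d = j div d ^ l mod d" if "l < p" for l
      using arg_cong[OF eq, of "\<lambda>xs. xs ! l"] that by (simp add: unflat_def)
    from mod_eq_of_digits_eq[of p, OF this] show "i = j" using ij by simp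
  qed
  have t: "tidx p d = {xs. set xs \<subseteq> {..<d} \<and> length xs = p}" by (auto simp: tidx_def)
  have "unflat p d ` {..<d ^ p} = tidx p d"
  proof (rule card_subset_eq)
    show "finite (tidx p d)" unfolding t by (rule finite_lists_length_eq) simp
    show "unflat p d ` {..<d ^ p} \<subseteq> tidx p d" using unflat_in_tidx[OF d] by auto
    show "card (unflat p d ` {..<d ^ p}) = card (tidx p d)"
      unfolding t card_image[OF inj] by (subst card_lists_length_eq) auto
  qed
  then show ?thesis using inj by (simp add: bij_betw_def)
qed

lemma enorm_cong:
  assumes "\<And>i j. i < d ^ p \<Longrightarrow> j < d ^ p \<Longrightarrow> C (unflat p d i @ unflat p d j) = C' (unflat p d i @ unflat p d j)"
  shows "enorm p d C = enorm p d C'"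
proof -
  have "tunfold p d C = tunfold p d C'"
    unfolding tunfold_def using assms by (intro cong_mat) auto
  then show ?thesis by (simp add: enorm_def einstein_eigenvalues_def)
qed

text \<open>\<open>dot v v > 0\<close> says that \<open>v\<close> is nonzero on
  \<open>{..<n}\<close>. This carries the matrix eigenvalues behind \<open>enorm\<close> over to
  matrices as functions.\<close>

lemma eigenvalue_mat_iff:
  fixes c :: "nat \<Rightarrow> nat \<Rightarrow> real"
  shows "eigenvalue (mat n n (\<lambda>(i, j). c i j)) k \<longleftrightarrow>
    (\<exists>v. fin_mat.dot {..<n} v v > 0 \<and> (\<forall>i<n. fin_mat.mv {..<n} c v i = k * v i))"
proof -
  interpret fin_mat "{..<n}" by standard simp
  have mvi: "(mat n n (\<lambda>(i, j). c i j) *\<^sub>v v) $ i = mv c (\<lambda>i. v $ i) i" if "i < n" "v \<in> carrier_vec n" for v i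
    using that by (simp add: scalar_prod_def mv_def atLeast0LessThan)
  show ?thesis
  proof
    assume "eigenvalue (mat n n (\<lambda>(i, j). c i j)) k"
    then obtain v where v: "v \<in> carrier_vec n" "v \<noteq> 0\<^sub>v n" "mat n n (\<lambda>(i, j). c i j) *\<^sub>v v = k \<cdot>\<^sub>v v"
      by (auto simp: eigenvalue_def eigenvector_def)
    have "\<exists>i<n. v $ i \<noteq> 0" using v(1,2) by (auto simp: vec_eq_iff)
    then have "dot (\<lambda>i. v $ i) (\<lambda>i. v $ i) \<noteq> 0" by (auto simp: dot_self_zero)
    moreover have "mv c (\<lambda>i. v $ i) i = k * v $ i" if "i < n" for i
      using mvi[OF that v(1)] v(1,3) that by simp
    ultimately show "\<exists>v. dot v v > 0 \<and> (\<forall>i<n. mv c v i = k * v i)"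
      using dot_self_nonneg[of "\<lambda>i. v $ i"] by (intro exI[of _ "\<lambda>i. v $ i"]) auto
  next
    assume "\<exists>v. dot v v > 0 \<and> (\<forall>i<n. mv c v i = k * v i)"
    then obtain v where v: "dot v v > 0" "\<forall>i<n. mv c v i = k * v i" by blast
    have "\<exists>i<n. v i \<noteq> 0" using v(1) dot_self_zero[of v] by (metis lessThan_iff less_irrefl)
    then have "vec n v \<noteq> 0\<^sub>v n" by (auto simp: vec_eq_iff)
    moreover have "mat n n (\<lambda>(i, j). c i j) *\<^sub>v vec n v = k \<cdot>\<^sub>v vec n v"
    proof (rule eq_vecI)
      fix i assume "i < dim_vec (k \<cdot>\<^sub>v vec n v)"
      then have i: "i < n" by simp
      have "(mat n n (\<lambda>(i, j). c i j) *\<^sub>v vec n v) $ i = mv c v i"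
        unfolding mvi[OF i vec_carrier] using i by (simp add: mv_def)
      then show "(mat n n (\<lambda>(i, j). c i j) *\<^sub>v vec n v) $ i = (k \<cdot>\<^sub>v vec n v) $ i"
        using v(2) i by simp
    qed simp
    ultimately show "eigenvalue (mat n n (\<lambda>(i, j). c i j)) k"
      unfolding eigenvalue_def eigenvector_def by (intro exI[of _ "vec n v"]) auto
  qed
qed

text \<open>The eigenvalues are the roots of the characteristic polynomial, so the maximum is
  attained; semidefiniteness removes the absolute value. The spectral theorem then identifies
  \<open>enorm\<close> with the largest Rayleigh quotient.\<close>

lemma enorm_psd:
  fixes C :: tensor and p d :: nat
  assumes d: "d \<ge> 1"
  defines "c \<equiv> \<lambda>i j. C (unflat p d i @ unflat p d j)"
  assumes sym: "fin_mat.symm {..<d ^ p} c"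
    and psd: "\<And>w. fin_mat.quad {..<d ^ p} c w \<ge> 0"
  shows "enorm p d C \<ge> 0"
    and "fin_mat.quad {..<d ^ p} c w \<le> enorm p d C * fin_mat.dot {..<d ^ p} w w"
    and "\<exists>v. fin_mat.dot {..<d ^ p} v v > 0 \<and> fin_mat.quad {..<d ^ p} c v = enorm p d C * fin_mat.dot {..<d ^ p} v v"
proof -
  interpret fin_mat "{..<d ^ p}" by standard simp
  let ?M = "mat (d ^ p) (d ^ p) (\<lambda>(i, j). c i j)"
  define S where "S = {k. eigenvalue ?M k}"
  have en: "enorm p d C = Max (abs ` S)"
    by (simp add: enorm_def einstein_eigenvalues_def tunfold_def S_def c_def)
  have "finite {k. poly (char_poly ?M) k = 0}"
  proof (rule poly_roots_finite)
    show "char_poly ?M \<noteq> 0" using degree_monic_char_poly[of ?M "d ^ p"] by auto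
  qed
  moreover have "S = {k. poly (char_poly ?M) k = 0}"
    unfolding S_def by (intro Collect_cong eigenvalue_root_char_poly[of _ "d ^ p"]) simp
  ultimately have fS: "finite S" by simp
  obtain l u where e: "eigdec c l u" by (rule spectral_theorem[OF sym])
  have lS: "l j \<in> S" if j: "j < d ^ p" for j
  proof -
    have "mv c (u j) i = l j * u j i" if i: "i < d ^ p" for i
    proof -
      have "mv c (u j) i = (\<Sum>k<d ^ p. \<Sum>m<d ^ p. l m * u m i * (u m k * u j k))"
        unfolding mv_def using eigdecD(2)[OF e] i
        by (intro sum.cong refl) (simp add: spec_def sum_distrib_right mult.assoc)
      also have "\<dots> = (\<Sum>m<d ^ p. l m * u m i * dot (u m) (u j))"
        by (subst sum.swap) (simp add: dot_def sum_distrib_left)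
      also have "\<dots> = (\<Sum>m<d ^ p. l m * u m i * kron m j)"
        using orthonormalD[OF eigdecD(1)[OF e]] j by (intro sum.cong refl) auto
      finally show ?thesis using j by simp
    qed
    moreover have "dot (u j) (u j) > 0"
      using orthonormalD[OF eigdecD(1)[OF e], of j j] j by (simp add: kron_def)
    ultimately show ?thesis unfolding S_def eigenvalue_mat_iff by blast
  qed
  \<comment> \<open>By \<open>d \<ge> 1\<close> the dimension \<open>d ^ p\<close> is positive, also
    for \<open>p = 0\<close>, so \<open>Max\<close> ranges over a nonempty set.\<close>
  have "S \<noteq> {}" using lS[of 0] d by auto
  then have "Max (abs ` S) \<in> abs ` S" using fS by (intro Max_in) auto
  then obtain k where k: "k \<in> S" "enorm p d C = \<bar>k\<bar>" by (auto simp: en)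
  then obtain v where v: "dot v v > 0" "\<forall>i<d ^ p. mv c v i = k * v i"
    unfolding S_def eigenvalue_mat_iff by blast
  have q: "quad c v = k * dot v v"
    unfolding quad_def dot_scale_right[symmetric] using v(2) by (intro dot_cong) auto
  then have "k \<ge> 0" using psd[of v] v(1) by (simp add: zero_le_mult_iff)
  then show "\<exists>v. dot v v > 0 \<and> quad c v = enorm p d C * dot v v" using k v q by auto
  show "enorm p d C \<ge> 0" using k by simp
  have "l j \<le> enorm p d C" if "j \<in> {..<d ^ p}" for j
  proof -
    have "\<bar>l j\<bar> \<le> enorm p d C" unfolding en using fS lS that by (intro Max_ge) auto
    then show ?thesis by simp
  qed
  then show "quad c w \<le> enorm p d C * dot w w" by (rule quad_bounded[OF e])
qed

subsection \<open>The self-adjoint dilation of a rectangular array\<close>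

text \<open>\<open>Inl\<close> marks rows and \<open>Inr\<close> columns of the array; the sum type
  keeps them apart without offsets.\<close>

definition dilation :: "(nat \<Rightarrow> nat \<Rightarrow> real) \<Rightarrow> nat + nat \<Rightarrow> nat + nat \<Rightarrow> real" where
  "dilation y u v = (case (u, v) of (Inl i, Inr k) \<Rightarrow> y i k | (Inr k, Inl i) \<Rightarrow> y i k | _ \<Rightarrow> 0)"

lemma dilation_simps [simp]:
  "dilation y (Inl i) (Inl j) = 0" "dilation y (Inl i) (Inr k) = y i k"
  "dilation y (Inr k) (Inl i) = y i k" "dilation y (Inr k) (Inr l) = 0"
  by (simp_all add: dilation_def)

lemma dilation_sum: "dilation (\<lambda>i k. \<Sum>m\<in>K. y m i k) u v = (\<Sum>m\<in>K. dilation (y m) u v)"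
  by (cases u; cases v) simp_all

locale rect =
  fixes a b :: nat
begin

abbreviation "J \<equiv> {..<a} <+> {..<b}"

sublocale L: fin_mat "{..<a}" by standard simp
sublocale R: fin_mat "{..<b}" by standard simp
sublocale D: fin_mat J by standard simp

definition gramL :: "(nat \<Rightarrow> nat \<Rightarrow> real) \<Rightarrow> nat \<Rightarrow> nat \<Rightarrow> real" where
  "gramL y = (\<lambda>i j. \<Sum>k<b. y i k * y j k)"

definition gramR :: "(nat \<Rightarrow> nat \<Rightarrow> real) \<Rightarrow> nat \<Rightarrow> nat \<Rightarrow> real" where
  "gramR y = (\<lambda>k l. \<Sum>i<a. y i k * y i l)"

lemma sum_J: "(\<Sum>u\<in>J. f u) = (\<Sum>i<a. f (Inl i)) + (\<Sum>k<b. f (Inr k))"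
  by (subst sum.Plus) (simp_all add: comp_def)

lemma card_J: "card J = a + b"
  by (simp add: card_Plus)

lemma dot_J: "D.dot v w = L.dot (\<lambda>i. v (Inl i)) (\<lambda>i. w (Inl i)) + R.dot (\<lambda>k. v (Inr k)) (\<lambda>k. w (Inr k))"
  by (simp add: D.dot_def L.dot_def R.dot_def sum_J)

lemma symm_dilation: "D.symm (dilation y)"
  by (auto simp: D.symm_def)

lemma quad_dilation: "D.quad (dilation y) w = 2 * R.dot (\<lambda>k. \<Sum>i<a. y i k * w (Inl i)) (\<lambda>k. w (Inr k))"
proof -
  have "(\<Sum>k<b. \<Sum>i<a. y i k * w (Inr k) * w (Inl i)) = (\<Sum>i<a. \<Sum>k<b. y i k * w (Inl i) * w (Inr k))"
    by (subst sum.swap) (simp add: mult_ac)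
  moreover have "R.dot (\<lambda>k. \<Sum>i<a. y i k * w (Inl i)) (\<lambda>k. w (Inr k)) = (\<Sum>i<a. \<Sum>k<b. y i k * w (Inl i) * w (Inr k))"
    unfolding R.dot_def sum_distrib_right by (rule sum.swap)
  ultimately show ?thesis by (simp add: D.quad_alt sum_J)
qed

lemma mmul_dilation:
  "D.mmul (dilation y) (dilation y) (Inl i) (Inl j) = gramL y i j"
  "D.mmul (dilation y) (dilation y) (Inr k) (Inr l) = gramR y k l"
  "D.mmul (dilation y) (dilation y) (Inl i) (Inr l) = 0"
  "D.mmul (dilation y) (dilation y) (Inr k) (Inl j) = 0"
  by (simp_all add: D.mmul_def sum_J gramL_def gramR_def)

lemma quad_block:
  assumes "\<And>i k. V (Inl i) (Inr k) = 0" "\<And>i k. V (Inr k) (Inl i) = 0"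
  shows "D.quad V w = L.quad (\<lambda>i j. V (Inl i) (Inl j)) (\<lambda>i. w (Inl i))
    + R.quad (\<lambda>k l. V (Inr k) (Inr l)) (\<lambda>k. w (Inr k))"
  using assms by (simp add: D.quad_alt L.quad_alt R.quad_alt sum_J)

lemma quad_gramL: "L.quad (gramL y) x = R.dot (\<lambda>k. \<Sum>i<a. y i k * x i) (\<lambda>k. \<Sum>i<a. y i k * x i)"
proof -
  have "L.quad (gramL y) x = (\<Sum>i<a. \<Sum>j<a. \<Sum>k<b. (y i k * x i) * (y j k * x j))"
    unfolding L.quad_alt gramL_def sum_distrib_right by (intro sum.cong refl) (simp add: mult_ac)
  also have "\<dots> = (\<Sum>k<b. \<Sum>i<a. \<Sum>j<a. (y i k * x i) * (y j k * x j))" by (rule sum_rotate3)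
  finally show ?thesis by (simp add: R.dot_def sum_product)
qed

lemma quad_gramR_nonneg: "R.quad (gramR y) x \<ge> 0"
proof -
  have "R.quad (gramR y) x = (\<Sum>k<b. \<Sum>l<b. \<Sum>i<a. (y i k * x k) * (y i l * x l))"
    unfolding R.quad_alt gramR_def sum_distrib_right by (intro sum.cong refl) (simp add: mult_ac)
  also have "\<dots> = (\<Sum>i<a. \<Sum>k<b. \<Sum>l<b. (y i k * x k) * (y i l * x l))" by (rule sum_rotate3)
  also have "\<dots> = (\<Sum>i<a. (\<Sum>k<b. y i k * x k)\<^sup>2)" by (simp add: sum_product power2_eq_square)
  finally show ?thesis by (simp add: sum_nonneg)
qed

lemma quad_gramL_nonneg: "L.quad (gramL y) x \<ge> 0"
  unfolding quad_gramL by (rule R.dot_self_nonneg)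

lemma symm_gram: "L.symm (gramL y)" "R.symm (gramR y)"
  by (simp_all add: L.symm_def R.symm_def gramL_def gramR_def mult.commute)

text \<open>With \<open>h\<close> the transpose of \<open>y\<close> applied to \<open>x\<close>, so
  that \<open>|h| \<le> s |x|\<close>, the squares \<open>|h - s z|^2\<close> and
  \<open>|h + s z|^2\<close> are nonnegative. Division by \<open>s\<close> gives the bound, which is
  why \<open>s = 0\<close> stands apart.\<close>

lemma quad_dilation_bounded:
  assumes s: "s \<ge> 0" and g: "\<And>x. L.quad (gramL y) x \<le> s\<^sup>2 * L.dot x x"
  shows "\<bar>D.quad (dilation y) w\<bar> \<le> s * D.dot w w"
proof -
  define x where "x = (\<lambda>i. w (Inl i))"
  define z where "z = (\<lambda>k. w (Inr k))"
  define h where "h = (\<lambda>k. \<Sum>i<a. y i k * x i)"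
  have hh: "R.dot h h \<le> s\<^sup>2 * L.dot x x" using g[of x] unfolding quad_gramL h_def .
  have q: "D.quad (dilation y) w = 2 * R.dot h z" and dw: "D.dot w w = L.dot x x + R.dot z z"
    by (simp_all add: quad_dilation dot_J h_def x_def z_def)
  show ?thesis
  proof (cases "s = 0")
    case True
    then have "R.dot h h = 0" using hh R.dot_self_nonneg[of h] by simp
    then have "R.dot h z = 0" unfolding R.dot_self_zero by (simp add: R.dot_def)
    then show ?thesis using True by (simp add: q)
  next
    case False
    then have s: "s > 0" using s by simp
    have "0 \<le> R.dot (\<lambda>k. h k - s * z k) (\<lambda>k. h k - s * z k)" by (rule R.dot_self_nonneg)
    also have "\<dots> = R.dot h h - 2 * s * R.dot h z + s\<^sup>2 * R.dot z z"
      unfolding R.dot_diff_left R.dot_diff_right R.dot_scale_left R.dot_scale_right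
      by (simp add: R.dot_commute[of z h] power2_eq_square algebra_simps)
    finally have 1: "2 * s * R.dot h z \<le> s\<^sup>2 * (L.dot x x + R.dot z z)"
      using hh by (simp add: algebra_simps)
    have "0 \<le> R.dot (\<lambda>k. h k + s * z k) (\<lambda>k. h k + s * z k)" by (rule R.dot_self_nonneg)
    also have "\<dots> = R.dot h h + 2 * s * R.dot h z + s\<^sup>2 * R.dot z z"
      unfolding R.dot_add_left R.dot_add_right R.dot_scale_left R.dot_scale_right
      by (simp add: R.dot_commute[of z h] power2_eq_square algebra_simps)
    finally have 2: "- (2 * s * R.dot h z) \<le> s\<^sup>2 * (L.dot x x + R.dot z z)"
      using hh by (simp add: algebra_simps)
    have "s * (2 * R.dot h z) \<le> s * (s * (L.dot x x + R.dot z z))"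
      using 1 by (simp only: power2_eq_square mult_ac)
    moreover have "s * (- (2 * R.dot h z)) \<le> s * (s * (L.dot x x + R.dot z z))"
      using 2 by (simp only: power2_eq_square mult_ac mult_minus_right)
    ultimately have "\<bar>2 * R.dot h z\<bar> \<le> s * (L.dot x x + R.dot z z)"
      unfolding mult_le_cancel_left_pos[OF s] by (rule abs_leI)
    then show ?thesis unfolding q dw .
  qed
qed

text \<open>The witness joins \<open>s x\<close> with the transpose of \<open>y\<close> applied to
  \<open>x\<close>. It vanishes at \<open>s = 0\<close>, where \<open>x\<close> padded with zeros
  serves instead.\<close>

lemma dilation_attains:
  assumes s: "s \<ge> 0" and x: "L.dot x x > 0" "L.quad (gramL y) x = s\<^sup>2 * L.dot x x"
  shows "\<exists>w. D.dot w w > 0 \<and> s * D.dot w w \<le> D.quad (dilation y) w"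
proof (cases "s = 0")
  case True
  define w where "w = case_sum x (\<lambda>_ :: nat. 0)"
  have "D.dot w w = L.dot x x" "D.quad (dilation y) w = 0"
    by (simp_all add: dot_J w_def quad_dilation R.dot_def)
  then show ?thesis using x True by (intro exI[of _ w]) simp
next
  case False
  then have s: "s > 0" using s by simp
  define w where "w = case_sum (\<lambda>i. s * x i) (\<lambda>k :: nat. \<Sum>i<a. y i k * x i)"
  have h: "R.dot (\<lambda>k. \<Sum>i<a. y i k * x i) (\<lambda>k. \<Sum>i<a. y i k * x i) = s\<^sup>2 * L.dot x x"
    using x(2) unfolding quad_gramL .
  have "D.dot w w = 2 * s\<^sup>2 * L.dot x x"
    unfolding dot_J w_def sum.case h L.dot_scale_left L.dot_scale_right by (simp add: power2_eq_square)
  moreover have "(\<lambda>k. \<Sum>i<a. y i k * w (Inl i)) = (\<lambda>k. s * (\<Sum>i<a. y i k * x i))"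
    by (simp add: w_def sum_distrib_left mult_ac)
  then have "D.quad (dilation y) w = 2 * s * (s\<^sup>2 * L.dot x x)"
    unfolding quad_dilation by (simp only: R.dot_scale_left) (simp add: w_def h)
  ultimately show ?thesis using s x(1) by (intro exI[of _ w]) simp
qed

end

subsection \<open>Tensors as rectangular arrays\<close>

definition tmatrix :: "nat \<Rightarrow> nat \<Rightarrow> tensor \<Rightarrow> nat \<Rightarrow> nat \<Rightarrow> real" where
  "tmatrix N d x i k = x (unflat (half_order N) d i @ unflat (N - half_order N) d k)"

lemma half_order_le: "N \<ge> 1 \<Longrightarrow> half_order N \<le> N"
  by (simp add: half_order_def)

lemma tprod_bar_unflat:
  assumes "d \<ge> 1"
  shows "tprod_bar N d A A (unflat (half_order N) d i @ unflat (half_order N) d j)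
    = rect.gramL (d ^ (N - half_order N)) (tmatrix N d A) i j"
  unfolding tprod_bar_def rect.gramL_def tmatrix_def
  by (subst sum.reindex_bij_betw[OF bij_betw_unflat[OF assms], symmetric]) simp

lemma tprod_under_unflat:
  assumes "d \<ge> 1"
  shows "tprod_under N d A A (unflat (N - half_order N) d k @ unflat (N - half_order N) d l)
    = rect.gramR (d ^ half_order N) (tmatrix N d A) k l"
  unfolding tprod_under_def rect.gramR_def tmatrix_def
  by (subst sum.reindex_bij_betw[OF bij_betw_unflat[OF assms], symmetric]) simp

lemma tmatrix_index_in_tidx:
  "\<lbrakk>N \<ge> 1; d \<ge> 1\<rbrakk> \<Longrightarrow> unflat (half_order N) d i @ unflat (N - half_order N) d k \<in> tidx N d"
  using unflat_append_in_tidx[of d "half_order N" i "N - half_order N" k] half_order_le[of N] by simp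

text \<open>\<open>gen_enorm\<close> is the largest singular value of the array; its square is the
  top eigenvalue of \<open>gramL\<close>.\<close>

lemma gen_enorm_gram:
  fixes A :: tensor and N d :: nat
  assumes d: "d \<ge> 1"
  defines "y \<equiv> tmatrix N d A" and "a \<equiv> d ^ half_order N" and "b \<equiv> d ^ (N - half_order N)"
  shows "gen_enorm N d A \<ge> 0"
    and "fin_mat.quad {..<a} (rect.gramL b y) x \<le> (gen_enorm N d A)\<^sup>2 * fin_mat.dot {..<a} x x"
    and "\<exists>v. fin_mat.dot {..<a} v v > 0 \<and>
      fin_mat.quad {..<a} (rect.gramL b y) v = (gen_enorm N d A)\<^sup>2 * fin_mat.dot {..<a} v v"
proof -
  interpret rect a b .
  have c: "(\<lambda>i j. tprod_bar N d A A (unflat (half_order N) d i @ unflat (half_order N) d j)) = gramL y"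
    by (simp add: tprod_bar_unflat[OF d] y_def b_def)
  note E = enorm_psd[where C = "tprod_bar N d A A" and p = "half_order N" and d = d,
      unfolded c a_def[symmetric], OF d symm_gram(1) quad_gramL_nonneg]
  have sq: "(gen_enorm N d A)\<^sup>2 = enorm (half_order N) d (tprod_bar N d A A)"
    using E(1) by (simp add: gen_enorm_def)
  show "gen_enorm N d A \<ge> 0" using E(1) by (simp add: gen_enorm_def)
  show "L.quad (gramL y) x \<le> (gen_enorm N d A)\<^sup>2 * L.dot x x"
    "\<exists>v. L.dot v v > 0 \<and> L.quad (gramL y) v = (gen_enorm N d A)\<^sup>2 * L.dot v v"
    unfolding sq using E(2,3) by blast+
qed

lemma tmatrix_tsum: "tmatrix N d (tsum n X \<omega>) i k = (\<Sum>m<n. tmatrix N d (X m \<omega>) i k)"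
  by (simp add: tmatrix_def tsum_def)

section \<open>Second moments of sums of independent tensors\<close>

text \<open>Off-diagonal expectations factor by independence and vanish because \<open>f\<close> has
  mean zero. With \<open>f\<close> and \<open>g\<close> two entries of the array, this yields the
  second form of the variance entry by entry.\<close>

lemma (in prob_space) indep_second_moment:
  fixes X :: "nat \<Rightarrow> 'a \<Rightarrow> 'b" and f g :: "'b \<Rightarrow> real"
  assumes ind: "indep_vars (\<lambda>_. N) X {..<n}"
    and m: "f \<in> borel_measurable N" "g \<in> borel_measurable N"
    and b: "\<And>k \<omega>. k < n \<Longrightarrow> \<omega> \<in> space M \<Longrightarrow> \<bar>f (X k \<omega>)\<bar> \<le> B" "\<And>k \<omega>. k < n \<Longrightarrow> \<omega> \<in> space M \<Longrightarrow> \<bar>g (X k \<omega>)\<bar> \<le> B"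
    and mean: "\<And>k. k < n \<Longrightarrow> expectation (\<lambda>\<omega>. f (X k \<omega>)) = 0"
  shows "\<And>k l. k < n \<Longrightarrow> l < n \<Longrightarrow> integrable M (\<lambda>\<omega>. f (X k \<omega>) * g (X l \<omega>))"
    and "integrable M (\<lambda>\<omega>. (\<Sum>k<n. f (X k \<omega>)) * (\<Sum>k<n. g (X k \<omega>)))"
    and "expectation (\<lambda>\<omega>. (\<Sum>k<n. f (X k \<omega>)) * (\<Sum>k<n. g (X k \<omega>))) = (\<Sum>k<n. expectation (\<lambda>\<omega>. f (X k \<omega>) * g (X k \<omega>)))"
proof -
  have rv: "X k \<in> measurable M N" if "k < n" for k
    using ind that by (auto simp: indep_vars_def)
  have mf: "(\<lambda>\<omega>. f (X k \<omega>)) \<in> borel_measurable M" and mg: "(\<lambda>\<omega>. g (X k \<omega>)) \<in> borel_measurable M" if "k < n" for k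
    using measurable_compose[OF rv[OF that]] m by auto
  have i_f: "integrable M (\<lambda>\<omega>. f (X k \<omega>))" and i_g: "integrable M (\<lambda>\<omega>. g (X k \<omega>))" if "k < n" for k
    using mf mg b that by (auto intro!: integrable_const_bound[of _ B] AE_I2)
  show int: "integrable M (\<lambda>\<omega>. f (X k \<omega>) * g (X l \<omega>))" if "k < n" "l < n" for k l
  proof (rule integrable_const_bound[of _ "B * B"])
    have "\<bar>f (X k \<omega>)\<bar> * \<bar>g (X l \<omega>)\<bar> \<le> B * B" if "\<omega> \<in> space M" for \<omega>
      using b(1)[OF \<open>k < n\<close> that] b(2)[OF \<open>l < n\<close> that] by (intro mult_mono) auto
    then show "AE \<omega> in M. norm (f (X k \<omega>) * g (X l \<omega>)) \<le> B * B"
      by (intro AE_I2) (simp add: abs_mult)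
    show "(\<lambda>\<omega>. f (X k \<omega>) * g (X l \<omega>)) \<in> borel_measurable M"
      using mf mg that by (intro borel_measurable_times)
  qed
  have cross: "expectation (\<lambda>\<omega>. f (X k \<omega>) * g (X l \<omega>)) = 0" if kl: "k < n" "l < n" "k \<noteq> l" for k l
  proof -
    have "indep_var (PiM {k} (\<lambda>_. N)) (\<lambda>\<omega>. restrict (\<lambda>i. X i \<omega>) {k}) (PiM {l} (\<lambda>_. N)) (\<lambda>\<omega>. restrict (\<lambda>i. X i \<omega>) {l})"
      by (rule indep_var_restrict[OF ind]) (use kl in auto)
    from indep_var_compose[OF this, of "\<lambda>x. f (x k)" borel "\<lambda>x. g (x l)" borel]
    have "indep_var borel (\<lambda>\<omega>. f (X k \<omega>)) borel (\<lambda>\<omega>. g (X l \<omega>))"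
      using m by (simp add: comp_def measurable_compose[OF measurable_component_singleton])
    from indep_var_lebesgue_integral[OF this i_f[OF kl(1)] i_g[OF kl(2)]] show ?thesis
      using mean[OF kl(1)] by simp
  qed
  show "integrable M (\<lambda>\<omega>. (\<Sum>k<n. f (X k \<omega>)) * (\<Sum>k<n. g (X k \<omega>)))"
    unfolding sum_product using int by (intro Bochner_Integration.integrable_sum) auto
  have "expectation (\<lambda>\<omega>. (\<Sum>k<n. f (X k \<omega>)) * (\<Sum>k<n. g (X k \<omega>)))
      = (\<Sum>k<n. \<Sum>l<n. expectation (\<lambda>\<omega>. f (X k \<omega>) * g (X l \<omega>)))"
    unfolding sum_product using int
    by (subst Bochner_Integration.integral_sum)
      (auto intro!: Bochner_Integration.integrable_sum sum.cong Bochner_Integration.integral_sum)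
  also have "\<dots> = (\<Sum>k<n. \<Sum>l<n. if l = k then expectation (\<lambda>\<omega>. f (X k \<omega>) * g (X k \<omega>)) else 0)"
    using cross by (intro sum.cong refl) auto
  finally show "expectation (\<lambda>\<omega>. (\<Sum>k<n. f (X k \<omega>)) * (\<Sum>k<n. g (X k \<omega>))) = (\<Sum>k<n. expectation (\<lambda>\<omega>. f (X k \<omega>) * g (X k \<omega>)))"
    by simp
qed

theorem theorem4p6:
  fixes M :: "'a measure" and X :: "nat \<Rightarrow> 'a \<Rightarrow> tensor"
    and N d n :: nat and L :: real
  assumes "prob_space M"
    and "N \<ge> 1" and "d \<ge> 1"
    and "prob_space.indep_vars M (\<lambda>_. PiM (tidx N d) (\<lambda>_. borel)) X {..<n}"
    and "\<And>k is. k < n \<Longrightarrow> is \<in> tidx N d \<Longrightarrow> texp M (X k) is = 0"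
    and "L \<ge> 0"
    and "\<And>k \<omega>. k < n \<Longrightarrow> \<omega> \<in> space M \<Longrightarrow> gen_enorm N d (X k \<omega>) \<le> L"
  shows "tnu M N d (tsum n X)
           = max (enorm (half_order N) d
                   (\<lambda>ij. \<Sum>k<n. texp M (\<lambda>\<omega>. tprod_bar N d (X k \<omega>) (X k \<omega>)) ij))
                 (enorm (N - half_order N) d
                   (\<lambda>kk. \<Sum>k<n. texp M (\<lambda>\<omega>. tprod_under N d (X k \<omega>) (X k \<omega>)) kk))
       \<and> prob_space.expectation M (\<lambda>\<omega>. gen_enorm N d (tsum n X \<omega>))
           \<le> sqrt (2 * tnu M N d (tsum n X)
                     * ln (real d ^ half_order N + real d ^ (N - half_order N)))
             + L * ln (real d ^ half_order N + real d ^ (N - half_order N)) / 3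
       \<and> (\<forall>t\<ge>0. prob_space.prob M {\<omega> \<in> space M. gen_enorm N d (tsum n X \<omega>) \<ge> t}
             \<le> (real d ^ half_order N + real d ^ (N - half_order N))
                * exp ((- (t ^ 2) / 2) / (tnu M N d (tsum n X) + L * t / 3)))"
proof -
  interpret prob_space M by fact
  note N = \<open>N \<ge> 1\<close> and d = \<open>d \<ge> 1\<close> and ind = assms(4) and L = \<open>L \<ge> 0\<close>
  define a where "a = d ^ half_order N"
  define b where "b = d ^ (N - half_order N)"
  interpret rect a b .
  define y where "y = (\<lambda>k \<omega>. tmatrix N d (X k \<omega>))"
  define F where "F = (\<lambda>x. dilation (tmatrix N d x))"
  define V where "V = (\<lambda>k u v. expectation (\<lambda>\<omega>. D.mmul (F (X k \<omega>)) (F (X k \<omega>)) u v))"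
  define CL where "CL = (\<lambda>ij. \<Sum>k<n. texp M (\<lambda>\<omega>. tprod_bar N d (X k \<omega>) (X k \<omega>)) ij)"
  define CR where "CR = (\<lambda>kk. \<Sum>k<n. texp M (\<lambda>\<omega>. tprod_under N d (X k \<omega>) (X k \<omega>)) kk)"
  \<comment> \<open>This is the variance as a sum over the summands; \<open>nu\<close> identifies it
    with \<open>tnu\<close>.\<close>
  define \<nu> where "\<nu> = max (enorm (half_order N) d CL) (enorm (N - half_order N) d CR)"
  let ?S = "\<lambda>\<omega>. gen_enorm N d (tsum n X \<omega>)"
  \<comment> \<open>Digits are taken modulo \<open>d\<close>, so the index list lies in
    \<open>tidx N d\<close> for all \<open>i\<close> and \<open>k\<close>.\<close>
  have mt: "(\<lambda>x. tmatrix N d x i k) \<in> borel_measurable (PiM (tidx N d) (\<lambda>_. borel))" for i k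
    unfolding tmatrix_def by (rule measurable_component_singleton[OF tmatrix_index_in_tidx[OF N d]])
  have mF: "(\<lambda>x. F x u v) \<in> borel_measurable (PiM (tidx N d) (\<lambda>_. borel))" for u v
    unfolding F_def by (cases u; cases v) (simp_all add: mt)
  have rv: "X k \<in> measurable M (PiM (tidx N d) (\<lambda>_. borel))" if "k < n" for k
    using ind that by (auto simp: indep_vars_def)
  have sF: "D.symm (F x)" for x by (simp add: F_def symm_dilation)
  have bF: "\<bar>D.quad (F (X k \<omega>)) w\<bar> \<le> L * D.dot w w" if "k < n" "\<omega> \<in> space M" for k \<omega> w
    unfolding F_def
  proof (rule quad_dilation_bounded[OF L])
    fix x
    note G = gen_enorm_gram[OF d, of N "X k \<omega>", folded a_def b_def]
    have "L.quad (gramL (tmatrix N d (X k \<omega>))) x \<le> (gen_enorm N d (X k \<omega>))\<^sup>2 * L.dot x x" by (rule G(2))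
    also have "\<dots> \<le> L\<^sup>2 * L.dot x x"
      using G(1) assms(7)[OF that] by (intro mult_right_mono power_mono L.dot_self_nonneg)
    finally show "L.quad (gramL (tmatrix N d (X k \<omega>))) x \<le> L\<^sup>2 * L.dot x x" .
  qed
  \<comment> \<open>An array entry is an off-diagonal entry of the dilation, whose eigenvalues lie
    between \<open>-L\<close> and \<open>L\<close>.\<close>
  have bt: "\<bar>tmatrix N d (X m \<omega>) i k\<bar> \<le> L" if "m < n" "\<omega> \<in> space M" "i < a" "k < b" for m \<omega> i k
    using D.entry_bound(1)[OF sF bF[OF that(1,2)] L, of "Inl i" "Inr k"] that by (auto simp: F_def)
  have mean0: "expectation (\<lambda>\<omega>. tmatrix N d (X m \<omega>) i k) = 0" if "m < n" for m i k
    using assms(5)[OF that tmatrix_index_in_tidx[OF N d]] by (simp add: texp_def tmatrix_def)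
  have meanF: "expectation (\<lambda>\<omega>. F (X k \<omega>) u v) = 0" if "k < n" for k u v
    unfolding F_def by (cases u; cases v) (simp_all add: mean0[OF that])
  note SM = indep_second_moment[OF ind mt mt, of _ _ L]
  have iL: "integrable M (\<lambda>\<omega>. gramL (y k \<omega>) i j)" if "k < n" "i < a" "j < a" for k i j
    unfolding gramL_def y_def using that bt mean0 by (intro Bochner_Integration.integrable_sum SM(1)) auto
  have iR: "integrable M (\<lambda>\<omega>. gramR (y k \<omega>) i j)" if "k < n" "i < b" "j < b" for k i j
    unfolding gramR_def y_def using that bt mean0 by (intro Bochner_Integration.integrable_sum SM(1)) auto
  have CL: "CL (unflat (half_order N) d i @ unflat (half_order N) d j) = (\<Sum>k<n. V k (Inl i) (Inl j))"
    and V_L: "V k (Inl i) (Inl j) = expectation (\<lambda>\<omega>. gramL (y k \<omega>) i j)" for k i j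
    by (simp_all add: CL_def texp_def tprod_bar_unflat[OF d] V_def F_def mmul_dilation y_def flip: b_def)
  have CR: "CR (unflat (N - half_order N) d i @ unflat (N - half_order N) d j) = (\<Sum>k<n. V k (Inr i) (Inr j))"
    and V_R: "V k (Inr i) (Inr j) = expectation (\<lambda>\<omega>. gramR (y k \<omega>) i j)" for k i j
    by (simp_all add: CR_def texp_def tprod_under_unflat[OF d] V_def F_def mmul_dilation y_def flip: a_def)
  have enL: "enorm (half_order N) d (texp M (\<lambda>\<omega>. tprod_bar N d (tsum n X \<omega>) (tsum n X \<omega>))) = enorm (half_order N) d CL"
  proof (rule enorm_cong)
    fix i j assume "i < d ^ half_order N" "j < d ^ half_order N"
    then have ij: "i < a" "j < a" by (simp_all add: a_def)
    have "texp M (\<lambda>\<omega>. tprod_bar N d (tsum n X \<omega>) (tsum n X \<omega>)) (unflat (half_order N) d i @ unflat (half_order N) d j)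
        = (\<Sum>k<b. expectation (\<lambda>\<omega>. (\<Sum>m<n. tmatrix N d (X m \<omega>) i k) * (\<Sum>m<n. tmatrix N d (X m \<omega>) j k)))"
      unfolding texp_def tprod_bar_unflat[OF d] b_def[symmetric] gramL_def tmatrix_tsum
      using ij bt mean0 by (intro Bochner_Integration.integral_sum SM(2)) auto
    also have "\<dots> = (\<Sum>k<b. \<Sum>m<n. expectation (\<lambda>\<omega>. tmatrix N d (X m \<omega>) i k * tmatrix N d (X m \<omega>) j k))"
      using ij bt mean0 by (intro sum.cong refl SM(3)) auto
    also have "\<dots> = (\<Sum>m<n. V m (Inl i) (Inl j))"
      unfolding V_L gramL_def y_def using ij bt mean0
      by (subst sum.swap) (intro sum.cong refl Bochner_Integration.integral_sum[symmetric] SM(1); auto)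
    finally show "texp M (\<lambda>\<omega>. tprod_bar N d (tsum n X \<omega>) (tsum n X \<omega>)) (unflat (half_order N) d i @ unflat (half_order N) d j)
      = CL (unflat (half_order N) d i @ unflat (half_order N) d j)" by (simp add: CL)
  qed
  have enR: "enorm (N - half_order N) d (texp M (\<lambda>\<omega>. tprod_under N d (tsum n X \<omega>) (tsum n X \<omega>))) = enorm (N - half_order N) d CR"
  proof (rule enorm_cong)
    fix k l assume "k < d ^ (N - half_order N)" "l < d ^ (N - half_order N)"
    then have kl: "k < b" "l < b" by (simp_all add: b_def)
    have "texp M (\<lambda>\<omega>. tprod_under N d (tsum n X \<omega>) (tsum n X \<omega>)) (unflat (N - half_order N) d k @ unflat (N - half_order N) d l)
        = (\<Sum>i<a. expectation (\<lambda>\<omega>. (\<Sum>m<n. tmatrix N d (X m \<omega>) i k) * (\<Sum>m<n. tmatrix N d (X m \<omega>) i l)))"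
      unfolding texp_def tprod_under_unflat[OF d] a_def[symmetric] gramR_def tmatrix_tsum
      using kl bt mean0 by (intro Bochner_Integration.integral_sum SM(2)) auto
    also have "\<dots> = (\<Sum>i<a. \<Sum>m<n. expectation (\<lambda>\<omega>. tmatrix N d (X m \<omega>) i k * tmatrix N d (X m \<omega>) i l))"
      using kl bt mean0 by (intro sum.cong refl SM(3)) auto
    also have "\<dots> = (\<Sum>m<n. V m (Inr k) (Inr l))"
      unfolding V_R gramR_def y_def using kl bt mean0
      by (subst sum.swap) (intro sum.cong refl Bochner_Integration.integral_sum[symmetric] SM(1); auto)
    finally show "texp M (\<lambda>\<omega>. tprod_under N d (tsum n X \<omega>) (tsum n X \<omega>)) (unflat (N - half_order N) d k @ unflat (N - half_order N) d l)
      = CR (unflat (N - half_order N) d k @ unflat (N - half_order N) d l)" by (simp add: CR)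
  qed
  have nu: "tnu M N d (tsum n X) = \<nu>"
    unfolding tnu_def enL enR \<nu>_def ..
  have sVL: "L.symm (\<lambda>i j. \<Sum>k<n. V k (Inl i) (Inl j))"
    unfolding V_L gramL_def L.symm_def by (simp add: mult.commute)
  have sVR: "R.symm (\<lambda>i j. \<Sum>k<n. V k (Inr i) (Inr j))"
    unfolding V_R gramR_def R.symm_def by (simp add: mult.commute)
  have pVL: "L.quad (\<lambda>i j. \<Sum>k<n. V k (Inl i) (Inl j)) w \<ge> 0" for w
  proof -
    have "0 \<le> expectation (\<lambda>\<omega>. L.quad (gramL (y k \<omega>)) w)" for k
      by (intro Bochner_Integration.integral_nonneg quad_gramL_nonneg)
    moreover have "expectation (\<lambda>\<omega>. L.quad (gramL (y k \<omega>)) w) = L.quad (\<lambda>i j. expectation (\<lambda>\<omega>. gramL (y k \<omega>) i j)) w"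
      if "k < n" for k
      using iL[OF that] by (intro L.quad_expectation(2)) auto
    ultimately show ?thesis unfolding L.quad_sum V_L by (intro sum_nonneg) (metis lessThan_iff)
  qed
  have pVR: "R.quad (\<lambda>i j. \<Sum>k<n. V k (Inr i) (Inr j)) w \<ge> 0" for w
  proof -
    have "0 \<le> expectation (\<lambda>\<omega>. R.quad (gramR (y k \<omega>)) w)" for k
      by (intro Bochner_Integration.integral_nonneg quad_gramR_nonneg)
    moreover have "expectation (\<lambda>\<omega>. R.quad (gramR (y k \<omega>)) w) = R.quad (\<lambda>i j. expectation (\<lambda>\<omega>. gramR (y k \<omega>) i j)) w"
      if "k < n" for k
      using iR[OF that] by (intro R.quad_expectation(2)) auto
    ultimately show ?thesis unfolding R.quad_sum V_R by (intro sum_nonneg) (metis lessThan_iff)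
  qed
  note EL = enorm_psd[where C = CL and p = "half_order N" and d = d, unfolded CL, folded a_def, OF d sVL pVL]
  note ER = enorm_psd[where C = CR and p = "N - half_order N" and d = d, unfolded CR, folded b_def, OF d sVR pVR]
  have nu0: "\<nu> \<ge> 0" using EL(1) by (simp add: \<nu>_def)
  have sV: "D.symm (\<lambda>u v. \<Sum>k<n. V k u v)"
    unfolding V_def using D.symm_mmul_self[OF sF] by (auto simp: D.symm_def intro!: sum.cong Bochner_Integration.integral_cong)
  \<comment> \<open>The squared dilation is block diagonal, so its form is bounded by the larger of
    the two block norms: this is the maximum in \<open>\<nu>\<close>.\<close>
  have qV: "D.quad (\<lambda>u v. \<Sum>k<n. V k u v) w \<le> \<nu> * D.dot w w" for w
  proof -
    let ?x = "\<lambda>i. w (Inl i)" and ?z = "\<lambda>k. w (Inr k)"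
    have "D.quad (\<lambda>u v. \<Sum>k<n. V k u v) w = L.quad (\<lambda>i j. \<Sum>k<n. V k (Inl i) (Inl j)) ?x
        + R.quad (\<lambda>i j. \<Sum>k<n. V k (Inr i) (Inr j)) ?z"
      by (rule quad_block) (simp_all add: V_def F_def mmul_dilation)
    also have "\<dots> \<le> enorm (half_order N) d CL * L.dot ?x ?x + enorm (N - half_order N) d CR * R.dot ?z ?z"
      by (intro add_mono EL(2) ER(2))
    also have "\<dots> \<le> \<nu> * L.dot ?x ?x + \<nu> * R.dot ?z ?z"
      unfolding \<nu>_def by (intro add_mono mult_right_mono L.dot_self_nonneg R.dot_self_nonneg) auto
    finally show ?thesis by (simp add: dot_J distrib_left)
  qed
  \<comment> \<open>The summand 0 is the matrix \<open>H\<close>, written out so that the bound for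
    sums applies as stated.\<close>
  define Z where "Z = (\<lambda>\<theta> \<omega>. D.mtr (D.mexp (\<lambda>u v. 0 + \<theta> * (\<Sum>k<n. F (X k \<omega>) u v))))"
  have mZ: "Z \<theta> \<in> borel_measurable M" for \<theta>
    unfolding Z_def using measurable_compose[OF rv mF]
    by (intro D.borel_measurable_mtr_mexp borel_measurable_add borel_measurable_times borel_measurable_sum) auto
  have SZ: "exp (\<theta> * ?S \<omega>) \<le> Z \<theta> \<omega>" if \<theta>: "\<theta> > 0" for \<theta> \<omega>
  proof -
    note G = gen_enorm_gram[OF d, of N "tsum n X \<omega>", folded a_def b_def]
    obtain v where v: "L.dot v v > 0" "L.quad (gramL (tmatrix N d (tsum n X \<omega>))) v = (?S \<omega>)\<^sup>2 * L.dot v v"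
      using G(3) by blast
    obtain w where w: "D.dot w w > 0" "?S \<omega> * D.dot w w \<le> D.quad (dilation (tmatrix N d (tsum n X \<omega>))) w"
      using dilation_attains[OF G(1) v] by blast
    have eq: "dilation (tmatrix N d (tsum n X \<omega>)) = (\<lambda>u v. \<Sum>k<n. F (X k \<omega>) u v)"
      unfolding F_def by (intro ext) (simp add: dilation_sum[symmetric] tmatrix_tsum[abs_def])
    show ?thesis unfolding Z_def
    proof (rule D.exp_rayleigh_le_mtr_mexp[OF _ w(1)])
      show "D.symm (\<lambda>u v. 0 + \<theta> * (\<Sum>k<n. F (X k \<omega>) u v))"
        using sF by (auto simp: D.symm_def intro!: sum.cong)
      show "\<theta> * ?S \<omega> * D.dot w w \<le> D.quad (\<lambda>u v. 0 + \<theta> * (\<Sum>k<n. F (X k \<omega>) u v)) w"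
        using w(2) \<theta> unfolding eq add_0 D.quad_scale by (simp add: mult.assoc)
    qed
  qed
  have bZ: "(\<integral>\<^sup>+\<omega>. ennreal (Z \<theta> \<omega>) \<partial>M) \<le> ennreal (real (a + b) * exp ((\<theta>\<^sup>2 / 2) / (1 - \<theta> * L / 3) * \<nu>))"
    if \<theta>: "\<theta> > 0" "\<theta> * L < 3" for \<theta>
  proof -
    let ?g = "(\<theta>\<^sup>2 / 2) / (1 - \<theta> * L / 3)"
    have g: "?g \<ge> 0" using \<theta> by (intro divide_nonneg_nonneg) auto
    have "(\<integral>\<^sup>+\<omega>. ennreal (Z \<theta> \<omega>) \<partial>M) \<le> ennreal (D.mtr (D.mexp (\<lambda>u v. 0 + ?g * (\<Sum>k<n. V k u v))))"
      unfolding Z_def V_def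
    proof (rule D.nn_integral_mtr_mexp_sum_le[OF \<open>prob_space M\<close> ind, where L = L])
      show "D.symm (\<lambda>u v. 0)" by (simp add: D.symm_def)
    qed (fact mF sF bF meanF L \<theta> | rule mF sF bF meanF; assumption)+
    also have "D.mtr (D.mexp (\<lambda>u v. 0 + ?g * (\<Sum>k<n. V k u v))) \<le> card J * exp (?g * \<nu>)"
    proof (rule D.mtr_mexp_le)
      show "D.symm (\<lambda>u v. 0 + ?g * (\<Sum>k<n. V k u v))"
        using sV by (simp add: D.symm_def)
      show "D.quad (\<lambda>u v. 0 + ?g * (\<Sum>k<n. V k u v)) w \<le> ?g * \<nu> * D.dot w w" for w
        unfolding add_0 D.quad_scale mult.assoc by (intro mult_left_mono qV g)
    qed
    finally show ?thesis by (simp add: card_J ennreal_leI)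
  qed
  have ab: "real (a + b) = real d ^ half_order N + real d ^ (N - half_order N)"
    by (simp add: a_def b_def)
  \<comment> \<open>For \<open>N = 1\<close> the second block has size \<open>d ^ 0 = 1\<close>, so
    the dimension is at least 2 and its logarithm positive in every case.\<close>
  have "a \<ge> 1" "b \<ge> 1" using d by (simp_all add: a_def b_def)
  then have D2: "real (a + b) \<ge> 2" by simp
  note B = bernstein_from_mgf[OF \<open>prob_space M\<close> D2 L nu0 mZ SZ bZ]
  show ?thesis
    using B unfolding nu ab by (simp add: \<nu>_def CL_def CR_def)
qed

end
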